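(* Let $K$ and $L$ be Gorenstein$^*$ simplicial complexes on disjoint vertex sets, of dimensions $d_K-1$ and $d_L-1$ respectively, with l.s.o.p.'s $\Theta_K$ (of $\mathbb{R}[K]$, consisting of linear forms in the variables of $K$) and $\Theta_L$ (of $\mathbb{R}[L]$, linear forms in the variables of $L$), and HL elements $\omega_K$ of $\mathbb{R}[K]/(\Theta_K)$ and $\omega_L$ of $\mathbb{R}[L]/(\Theta_L)$, all over $\mathbb{R}$. Then: (0) the join $K*L$ has dimension $d_K+d_L-1$ and a symmetric $h$-vector; (1) $\Theta_K\uplus\Theta_L$ is an l.s.o.p. for $\mathbb{R}[K*L]$ over $\mathbb{R}$; (2) $\omega_K+\omega_L$ is an HL element of $\mathbb{R}[K*L]/(\Theta_K\uplus\Theta_L)$.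
   Context: For a simplicial complex $K$ on a finite vertex set $V$, let $A_V=\mathbb{R}[x_v:v\in V]$ with each $x_v$ of degree one, and $\mathbb{R}[K]=A_V/I_K$ where $I_K$ is generated by the monomials $\prod_{v\in S}x_v$, $S\notin K$. If $\dim K=d-1$, an l.s.o.p. is $\Theta=(\theta_1,\dots,\theta_d)\in (A_V)_1^d$ with $\mathbb{R}[K]/(\Theta)$ finite-dimensional over $\mathbb{R}$. The join of complexes on disjoint vertex sets is $K*L=\{F\cup G:F\in K,G\in L\}$, with face ring viewed over $\mathbb{R}[x_v:v\in K_0\uplus L_0]$. A Gorenstein$^*$ complex is a pure complex such that for every face $F$ (including $\emptyset$), $\mathrm{lk}(F,K)$ has the homology of a sphere of dimension $\dim\mathrm{lk}(F,K)$. For a $(d-1)$-dimensional complex with l.s.o.p. $\Theta$ and $H=\mathbb{R}[K]/(\Theta)=\bigoplus H_i$, an element $\omega$ of degree one is an HL element of $H$ if multiplication $\omega^{d-2i}:H_i\to H_{d-i}$ is an isomorphism for all $0\le i\le\lfloor d/2\rfloor$. *)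

theory Defs
  imports
    "HOL-Library.Poly_Mapping"
    "HOL-Library.Function_Algebras"
    "HOL-Algebra.QuotRing"
    "HOL-Algebra.Embedded_Algebras"
begin

section \<open>Simplicial complexes\<close>

text \<open>The empty face always belongs to a complex, so the smallest complex is \<open>{{}}\<close>, of dimension
  \<open>-1\<close>. A point of the ground set \<open>V\<close> need not be a vertex: if \<open>{v}\<close> is not a face, then \<open>x\<^sub>v\<close> is
  one of the generators of the face ideal.\<close>

definition simplicial_complex :: "'v set \<Rightarrow> 'v set set \<Rightarrow> bool" where
  "simplicial_complex V K \<longleftrightarrow>
     finite V \<and> K \<subseteq> Pow V \<and> {} \<in> K \<and> (\<forall>F\<in>K. \<forall>G. G \<subseteq> F \<longrightarrow> G \<in> K)"

definition complex_dim :: "'v set set \<Rightarrow> int" where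
  "complex_dim K = int (Max (card ` K)) - 1"

definition pure_complex :: "'v set set \<Rightarrow> bool" where
  "pure_complex K \<longleftrightarrow>
     (\<forall>F\<in>K. (\<forall>G\<in>K. F \<subseteq> G \<longrightarrow> G = F) \<longrightarrow> int (card F) - 1 = complex_dim K)"

definition link :: "'v set \<Rightarrow> 'v set set \<Rightarrow> 'v set set" where
  "link F K = {G \<in> K. F \<inter> G = {} \<and> F \<union> G \<in> K}"

definition complex_join :: "'v set set \<Rightarrow> 'v set set \<Rightarrow> 'v set set" where
  "complex_join K L = {F \<union> G | F G. F \<in> K \<and> G \<in> L}"

text \<open>\<open>h_vector K j\<close> is the coefficient of \<open>t\<^sup>j\<close> in \<open>\<Sum>\<^sub>i f\<^bsub>i-1\<^esub> t\<^sup>i (1 - t)\<^bsup>d-i\<^esup>\<close>, where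
  \<open>dim K = d - 1\<close> and \<open>f\<^bsub>i-1\<^esub>\<close> is the number of faces with \<open>i\<close> elements.\<close>

definition h_vector :: "'v set set \<Rightarrow> nat \<Rightarrow> int" where
  "h_vector K j = (let d = nat (complex_dim K + 1) in
     \<Sum>i\<le>j. (- 1) ^ (j - i) * int ((d - i) choose (j - i)) * int (card {F \<in> K. card F = i}))"

definition symmetric_h_vector :: "'v set set \<Rightarrow> bool" where
  "symmetric_h_vector K \<longleftrightarrow>
     (let d = nat (complex_dim K + 1) in \<forall>j\<le>d. h_vector K j = h_vector K (d - j))"


section \<open>Reduced simplicial homology with real coefficients\<close>

text \<open>Faces are oriented by an arbitrary linear order of the vertices; up to isomorphism the homology
  does not depend on it. Chains are indexed by the cardinality \<open>k\<close> of the faces, that is,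
  \<open>chains K k\<close> is the chain space in degree \<open>k - 1\<close>, and the empty face (\<open>k = 0\<close>) gives the
  augmentation.\<close>

definition vertex_order :: "'v rel" where
  "vertex_order = (SOME r. linear_order_on UNIV r)"

lemma linear_order_vertex_order: "linear_order_on UNIV vertex_order"
proof -
  obtain r :: "'a rel" where "well_order_on UNIV r"
    using well_order_on by blast
  then have "linear_order_on UNIV r"
    by (simp add: well_order_on_def)
  then show ?thesis
    unfolding vertex_order_def by (rule someI)
qed

definition chains :: "'v set set \<Rightarrow> nat \<Rightarrow> ('v set \<Rightarrow> real) set" where
  "chains K k = {c. \<forall>F. c F \<noteq> 0 \<longrightarrow> F \<in> K \<and> card F = k}"

text \<open>The coefficient of \<open>\<partial> c\<close> at \<open>G\<close> collects the contributions of all faces \<open>insert v G\<close>; the sign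
  is \<open>(-1)\<^sup>p\<close>, where \<open>p\<close> is the position of \<open>v\<close> in \<open>insert v G\<close>.\<close>

definition boundary :: "'v set set \<Rightarrow> ('v set \<Rightarrow> real) \<Rightarrow> 'v set \<Rightarrow> real" where
  "boundary K c = (\<lambda>G. \<Sum>v\<in>\<Union>K - G. (- 1) ^ card {u \<in> G. (u, v) \<in> vertex_order} * c (insert v G))"

definition cycles :: "'v set set \<Rightarrow> nat \<Rightarrow> ('v set \<Rightarrow> real) set" where
  "cycles K k = {c \<in> chains K k. boundary K c = 0}"

definition boundaries :: "'v set set \<Rightarrow> nat \<Rightarrow> ('v set \<Rightarrow> real) set" where
  "boundaries K k = boundary K ` chains K (Suc k)"

definition chain_scale :: "real \<Rightarrow> ('v set \<Rightarrow> real) \<Rightarrow> 'v set \<Rightarrow> real" where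
  "chain_scale r c = (\<lambda>F. r * c F)"

lemma vector_space_chain_scale: "vector_space chain_scale"
  by unfold_locales (auto simp: chain_scale_def fun_eq_iff algebra_simps)

text \<open>The dimension of the reduced homology \<open>Z / B\<close> in degree \<open>k - 1\<close>.\<close>

definition reduced_betti :: "'v set set \<Rightarrow> nat \<Rightarrow> nat" where
  "reduced_betti K k =
     vector_space.dim chain_scale (cycles K k) - vector_space.dim chain_scale (boundaries K k)"

definition has_homology_of_sphere :: "'v set set \<Rightarrow> int \<Rightarrow> bool" where
  "has_homology_of_sphere K n \<longleftrightarrow>
     (\<forall>k. reduced_betti K k = (if int k - 1 = n then 1 else 0))"

definition gorenstein_star :: "'v set set \<Rightarrow> bool" where
  "gorenstein_star K \<longleftrightarrow>
     pure_complex K \<and> (\<forall>F\<in>K. has_homology_of_sphere (link F K) (complex_dim (link F K)))"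


section \<open>Polynomial rings and face rings\<close>

text \<open>A monomial is a finitely supported exponent vector \<open>'v \<Rightarrow>\<^sub>0 nat\<close>, and the product of the type
  of polynomials is the convolution product.\<close>

type_synonym 'v mpoly = "('v \<Rightarrow>\<^sub>0 nat) \<Rightarrow>\<^sub>0 real"

definition poly_ring :: "'v set \<Rightarrow> 'v mpoly ring" where
  "poly_ring V = \<lparr>carrier = {p. \<forall>m\<in>Poly_Mapping.keys p. Poly_Mapping.keys m \<subseteq> V},
     mult = (*), one = 1, zero = 0, add = (+)\<rparr>"

lemma cring_poly_ring: "cring (poly_ring V)"
proof (rule cringI)
  show "abelian_group (poly_ring V)"
  proof (rule abelian_groupI)
    fix p assume "p \<in> carrier (poly_ring V)"
    then show "\<exists>q\<in>carrier (poly_ring V). q \<oplus>\<^bsub>poly_ring V\<^esub> p = \<zero>\<^bsub>poly_ring V\<^esub>"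
      by (intro bexI[of _ "- p"]) (auto simp: poly_ring_def in_keys_iff)
  next
    fix p q assume "p \<in> carrier (poly_ring V)" "q \<in> carrier (poly_ring V)"
    then show "p \<oplus>\<^bsub>poly_ring V\<^esub> q \<in> carrier (poly_ring V)"
      using Poly_Mapping.keys_add[of p q] by (auto simp: poly_ring_def)
  qed (auto simp: poly_ring_def algebra_simps)
  show "Group.comm_monoid (poly_ring V)"
  proof (rule comm_monoidI)
    fix p q assume p: "p \<in> carrier (poly_ring V)" and q: "q \<in> carrier (poly_ring V)"
    have "Poly_Mapping.keys m \<subseteq> V" if m: "m \<in> Poly_Mapping.keys (p * q)" for m
    proof -
      obtain a b where "a \<in> Poly_Mapping.keys p" "b \<in> Poly_Mapping.keys q" "m = a + b"
        using m keys_mult[of p q] by blast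
      then show ?thesis
        using p q Poly_Mapping.keys_add[of a b] by (fastforce simp: poly_ring_def)
    qed
    then show "p \<otimes>\<^bsub>poly_ring V\<^esub> q \<in> carrier (poly_ring V)"
      by (auto simp: poly_ring_def)
  qed (auto simp: poly_ring_def algebra_simps)
qed (auto simp: poly_ring_def algebra_simps)

definition pvar :: "'v \<Rightarrow> 'v mpoly" where
  "pvar v = Poly_Mapping.single (Poly_Mapping.single v 1) 1"

definition pconst :: "real \<Rightarrow> 'v mpoly" where
  "pconst r = Poly_Mapping.single 0 r"

definition homogeneous_polys :: "'v set \<Rightarrow> nat \<Rightarrow> 'v mpoly set" where
  "homogeneous_polys V i =
     {p \<in> carrier (poly_ring V).
        \<forall>m\<in>Poly_Mapping.keys p. (\<Sum>v\<in>Poly_Mapping.keys m. Poly_Mapping.lookup m v) = i}"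

definition face_ideal :: "'v set \<Rightarrow> 'v set set \<Rightarrow> 'v mpoly set" where
  "face_ideal V K = Idl\<^bsub>poly_ring V\<^esub> {\<Prod>v\<in>S. pvar v | S. S \<subseteq> V \<and> S \<notin> K}"

definition face_ring :: "'v set \<Rightarrow> 'v set set \<Rightarrow> 'v mpoly set ring" where
  "face_ring V K = poly_ring V Quot face_ideal V K"

definition face_class :: "'v set \<Rightarrow> 'v set set \<Rightarrow> 'v mpoly \<Rightarrow> 'v mpoly set" where
  "face_class V K p = face_ideal V K +>\<^bsub>poly_ring V\<^esub> p"

definition param_ideal ::
    "'v set \<Rightarrow> 'v set set \<Rightarrow> 'v mpoly list \<Rightarrow> 'v mpoly set set" where
  "param_ideal V K \<Theta> = Idl\<^bsub>face_ring V K\<^esub> (face_class V K ` set \<Theta>)"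

definition reduced_face_ring ::
    "'v set \<Rightarrow> 'v set set \<Rightarrow> 'v mpoly list \<Rightarrow> 'v mpoly set set ring" where
  "reduced_face_ring V K \<Theta> = face_ring V K Quot param_ideal V K \<Theta>"

text \<open>The image of a polynomial under \<open>A\<^sub>V \<rightarrow> \<real>[K] \<rightarrow> \<real>[K]/(\<Theta>)\<close>.\<close>

definition reduced_class ::
    "'v set \<Rightarrow> 'v set set \<Rightarrow> 'v mpoly list \<Rightarrow> 'v mpoly \<Rightarrow> 'v mpoly set set" where
  "reduced_class V K \<Theta> p = param_ideal V K \<Theta> +>\<^bsub>face_ring V K\<^esub> face_class V K p"

text \<open>The field \<open>\<real>\<close> acts on \<open>\<real>[K]/(\<Theta>)\<close> through the classes of the constant polynomials.\<close>

definition is_lsop :: "'v set \<Rightarrow> 'v set set \<Rightarrow> 'v mpoly list \<Rightarrow> bool" where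
  "is_lsop V K \<Theta> \<longleftrightarrow>
     int (length \<Theta>) = complex_dim K + 1 \<and>
     set \<Theta> \<subseteq> homogeneous_polys V 1 \<and>
     ring.finite_dimension (reduced_face_ring V K \<Theta>)
       (range (\<lambda>r. reduced_class V K \<Theta> (pconst r))) (carrier (reduced_face_ring V K \<Theta>))"

definition graded_piece ::
    "'v set \<Rightarrow> 'v set set \<Rightarrow> 'v mpoly list \<Rightarrow> nat \<Rightarrow> 'v mpoly set set set" where
  "graded_piece V K \<Theta> i = reduced_class V K \<Theta> ` homogeneous_polys V i"

text \<open>Multiplication by a ring element is linear, so it is an isomorphism between graded pieces as
  soon as it is a bijection.\<close>

definition HL_element ::
    "'v set \<Rightarrow> 'v set set \<Rightarrow> 'v mpoly list \<Rightarrow> 'v mpoly set set \<Rightarrow> bool" where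
  "HL_element V K \<Theta> \<omega> \<longleftrightarrow>
     (let d = nat (complex_dim K + 1); H = reduced_face_ring V K \<Theta> in
        \<omega> \<in> graded_piece V K \<Theta> 1 \<and>
        (\<forall>i\<le>d div 2.
           bij_betw (\<lambda>x. (\<omega> [^]\<^bsub>H\<^esub> (d - 2 * i)) \<otimes>\<^bsub>H\<^esub> x)
             (graded_piece V K \<Theta> i) (graded_piece V K \<Theta> (d - i))))"

end

theory Submission
  imports Defs
begin

text \<open>Let \<open>H\<^sub>K\<close>, \<open>H\<^sub>L\<close> and \<open>H\<close> be the quotients of the face rings of \<open>K\<close>, \<open>L\<close> and \<open>K * L\<close>, so that
  \<open>H = H\<^sub>K \<otimes> H\<^sub>L\<close>. On a graded space living in degrees \<open>0, \<dots>, d\<close>, an operator \<open>e\<close> of degree one has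
  the hard Lefschetz property iff it is part of an \<open>sl\<^sub>2\<close>-triple, that is, iff there is an
  operator \<open>f\<close> of degree \<open>-1\<close> with \<open>e f - f e = 2j - d\<close> in degree \<open>j\<close>. If \<open>f\<^sub>K\<close> and \<open>f\<^sub>L\<close> are such
  operators for \<open>\<omega>\<^sub>K\<close> and \<open>\<omega>\<^sub>L\<close>, then \<open>f\<^sub>K \<otimes> 1 + 1 \<otimes> f\<^sub>L\<close> is one for \<open>\<omega>\<^sub>K + \<omega>\<^sub>L\<close>. Quotients and tensor
  products are avoided by working with operators on the polynomial ring \<open>A\<^bsub>V\<^esub>\<close>, whose monomials
  split into a part in \<open>V\<^sub>K\<close> and a part in \<open>V\<^sub>L\<close>, modulo the subspace \<open>J\<close> of relations. That \<open>H\<^sub>K\<close>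
  vanishes above degree \<open>d\<^sub>K\<close> holds for every l.s.o.p.

  The symmetry of the \<open>h\<close>-vector follows from the Euler characteristics of the links: they say that
  \<open>\<Sum>\<^bsub>G \<supseteq> F\<^esub> (-1)\<^bsup>d-|G|\<^esup> = 1\<close> for every face \<open>F\<close>, a condition that is multiplicative under
  joins and implies the Dehn-Sommerville relations.\<close>

section \<open>Graded quotients\<close>

text \<open>Powers of a sum of two operators mix the factors, so bijectivity of powers does not pass
  directly to a tensor product. A commutator does: operators on different factors commute, and the
  weights 2i - d_K and 2j - d_L add up to the weight of the product. Getting bijectivity back rests
  on the constants of sl2 theory, which are nonzero integers in the relevant degrees and hence
  invertible over the reals. The hard Lefschetz property does not mention degrees above d, yet the
  argument needs e to kill degree d: surjectivity is proved downwards from there, and the commutator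
  in degree d sees e x. The required vanishing comes from evaluation at points. If a variable of a
  face F were not a combination of the parameters and of the variables outside F, the parameters
  would vanish on a line in the coordinate subspace of F along which that variable is not constant,
  and its powers would be linearly independent in the quotient. So a repeated variable can be traded
  for new ones until the support is no longer a face.\<close>

locale graded_quotient =
  fixes A :: "nat \<Rightarrow> 'a::real_vector set" and J :: "'a set" and e :: "'a \<Rightarrow> 'a" and d :: nat
  assumes subspace_A: "subspace (A j)"
    and subspace_J: "subspace J"
    and linear_e: "linear e"
    and e_A: "x \<in> A j \<Longrightarrow> e x \<in> A (Suc j)"
    and e_J: "x \<in> J \<Longrightarrow> e x \<in> J"
    and top_degree: "d < j \<Longrightarrow> A j \<subseteq> J"
begin

definition lefschetz :: bool where
  "lefschetz \<longleftrightarrow> (\<forall>i. 2 * i \<le> d \<longrightarrow>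
     (\<forall>x\<in>A i. (e ^^ (d - 2 * i)) x \<in> J \<longrightarrow> x \<in> J) \<and>
     (\<forall>y\<in>A (d - i). \<exists>x\<in>A i. (e ^^ (d - 2 * i)) x - y \<in> J))"

text \<open>The commutator is the weight operator of the sl2-triple. The operator is a family
  indexed by the degree because an element of the ambient space need not determine its degree; for
  the same reason the conditions involving \<open>J\<close> are imposed only on the piece of the
  matching degree.\<close>

definition lowering :: "(nat \<Rightarrow> 'a \<Rightarrow> 'a) \<Rightarrow> bool" where
  "lowering f \<longleftrightarrow> (\<forall>j. linear (f j)) \<and> (\<forall>x. f 0 x = 0) \<and>
     (\<forall>j. \<forall>x\<in>A (Suc j). f (Suc j) x \<in> A j) \<and> (\<forall>j. \<forall>x\<in>A j \<inter> J. f j x \<in> J) \<and>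
     (\<forall>j. \<forall>x\<in>A j. e (f j x) - f (Suc j) (e x) - (2 * real j - real d) *\<^sub>R x \<in> J)"

lemma linear_pow: "linear (e ^^ n)"
proof (induction n)
  case (Suc n)
  then show ?case
    using linear_compose[OF Suc linear_e] by (simp add: comp_def)
qed (auto intro: linearI)

lemma pow_A: "x \<in> A j \<Longrightarrow> (e ^^ n) x \<in> A (j + n)"
  by (induction n) (auto simp: e_A)

lemma pow_A': "x \<in> A j \<Longrightarrow> k = j + n \<Longrightarrow> (e ^^ n) x \<in> A k"
  using pow_A by blast

lemma pow_J: "x \<in> J \<Longrightarrow> (e ^^ n) x \<in> J"
  by (induction n) (auto simp: e_J)

lemma pow_Suc2: "(e ^^ n) (e x) = (e ^^ Suc n) x"
  by (simp add: funpow_swap1)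

lemmas e_simps = linear_add[OF linear_e] linear_diff[OF linear_e] linear_scale[OF linear_e]
  linear_0[OF linear_e]
lemmas pow_simps = linear_add[OF linear_pow] linear_diff[OF linear_pow] linear_scale[OF linear_pow]
  linear_0[OF linear_pow]
lemmas J_closed = subspace_add[OF subspace_J] subspace_diff[OF subspace_J]
  subspace_scale[OF subspace_J] subspace_0[OF subspace_J] subspace_neg[OF subspace_J]
lemmas A_closed = subspace_add[OF subspace_A] subspace_diff[OF subspace_A]
  subspace_scale[OF subspace_A] subspace_0[OF subspace_A]

lemma J_trans: "x - y \<in> J \<Longrightarrow> y - z \<in> J \<Longrightarrow> x - z \<in> J"
  using J_closed(1)[of "x - y" "y - z"] by simp

lemma J_cancel: "x - y \<in> J \<Longrightarrow> y \<in> J \<Longrightarrow> x \<in> J"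
  using J_closed(1)[of "x - y" y] by simp

lemma J_cancel2: "x - y \<in> J \<Longrightarrow> x \<in> J \<Longrightarrow> y \<in> J"
  using J_closed(2)[of x "x - y"] by simp

lemma J_scaleD: "c *\<^sub>R x \<in> J \<Longrightarrow> c \<noteq> 0 \<Longrightarrow> x \<in> J"
  using J_closed(3)[of "c *\<^sub>R x" "inverse c"] by simp

section \<open>The hard Lefschetz property from a lowering operator\<close>

context
  fixes f assumes f: "lowering f"
begin

lemma linear_f: "linear (f j)" and f_zero: "f 0 x = 0"
  and f_A: "x \<in> A (Suc j) \<Longrightarrow> f (Suc j) x \<in> A j"
  and f_J: "x \<in> A j \<Longrightarrow> x \<in> J \<Longrightarrow> f j x \<in> J"
  and commutator: "x \<in> A j \<Longrightarrow> e (f j x) - f (Suc j) (e x) - (2 * real j - real d) *\<^sub>R x \<in> J"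
  using f by (auto simp: lowering_def)

text \<open>Moving \<open>f\<close> past \<open>Suc s\<close> copies of \<open>e\<close> collects
  the weights \<open>2 (i + t) - d\<close> for t = 0, ..., s. Their sum is the constant.\<close>

lemma commutator_pow:
  assumes x: "x \<in> A i"
  shows "f (i + Suc s) ((e ^^ Suc s) x) - (e ^^ Suc s) (f i x)
    + (real (Suc s) * (2 * real i + real s - real d)) *\<^sub>R (e ^^ s) x \<in> J"
proof (induction s)
  case 0
  show ?case
    using J_closed(5)[OF commutator[OF x]] by (simp add: algebra_simps)
next
  case (Suc s)
  let ?c = "real (Suc s) * (2 * real i + real s - real d)"
  have 1: "e (f (i + Suc s) ((e ^^ Suc s) x)) - f (Suc (i + Suc s)) (e ((e ^^ Suc s) x))
      - (2 * real (i + Suc s) - real d) *\<^sub>R (e ^^ Suc s) x \<in> J"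
    by (rule commutator) (use pow_A[OF x, of "Suc s"] in simp)
  have 2: "e (f (i + Suc s) ((e ^^ Suc s) x)) - e ((e ^^ Suc s) (f i x)) + ?c *\<^sub>R e ((e ^^ s) x) \<in> J"
    using e_J[OF Suc] by (simp add: e_simps)
  have c: "real (Suc (Suc s)) * (2 * real i + real (Suc s) - real d) = ?c + (2 * real (i + Suc s) - real d)"
    by (simp add: algebra_simps)
  show ?case
    using J_closed(2)[OF 2 1] unfolding c scaleR_add_left by (simp add: algebra_simps)
qed

text \<open>If e^(s+1) x is a relation, applying \<open>f\<close> shows that e^s x is, up to a
  nonzero constant, congruent to e^(s+1) (f x). One more \<open>e\<close> makes e^(s+2) (f x) a
  relation, and the induction on the degree applies to \<open>f x\<close>. It therefore has to range
  over all exponents \<open>s\<close> with \<open>2 * i + s \<le> d\<close>, not only over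
  \<open>d - 2 * i\<close>.\<close>

lemma injective_mod:
  "x \<in> A i \<Longrightarrow> 2 * i + s \<le> d \<Longrightarrow> (e ^^ s) x \<in> J \<Longrightarrow> x \<in> J"
proof (induction i arbitrary: x s)
  case (0 x s)
  then show ?case
  proof (induction s)
    case (Suc s)
    have fJ: "f (0 + Suc s) ((e ^^ Suc s) x) \<in> J"
      by (rule f_J) (use pow_A'[OF \<open>x \<in> A 0\<close>, of "Suc s" "Suc s"] Suc in auto)
    have "(real (Suc s) * (2 * real 0 + real s - real d)) *\<^sub>R (e ^^ s) x \<in> J"
      using J_closed(2)[OF commutator_pow[OF \<open>x \<in> A 0\<close>, of s] fJ] by (simp add: f_zero pow_simps e_simps)
    moreover have "real (Suc s) * (2 * real 0 + real s - real d) \<noteq> 0"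
      using Suc by simp
    ultimately have "(e ^^ s) x \<in> J"
      using J_scaleD by blast
    then show ?case
      using Suc by auto
  qed auto
next
  case (Suc i x s)
  have IH: "x \<in> A i \<Longrightarrow> 2 * i + s \<le> d \<Longrightarrow> (e ^^ s) x \<in> J \<Longrightarrow> x \<in> J" for x s
    using Suc.IH .
  from Suc.prems show ?case
  proof (induction s)
    case (Suc s)
    note x = \<open>x \<in> A (Suc i)\<close>
    let ?c = "real (Suc s) * (2 * real (Suc i) + real s - real d)"
    have c: "?c \<noteq> 0"
      using Suc by simp
    have fJ: "f (Suc i + Suc s) ((e ^^ Suc s) x) \<in> J"
      by (rule f_J) (use pow_A'[OF x, of _ "Suc s"] Suc in auto)
    have 1: "?c *\<^sub>R (e ^^ s) x - (e ^^ Suc s) (f (Suc i) x) \<in> J"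
      using J_closed(2)[OF commutator_pow[OF x, of s] fJ] by simp
    then have "?c *\<^sub>R (e ^^ Suc s) x - (e ^^ Suc (Suc s)) (f (Suc i) x) \<in> J"
      using e_J[OF 1] by (simp add: e_simps)
    then have "(e ^^ Suc (Suc s)) (f (Suc i) x) \<in> J"
      using J_cancel2 Suc.prems(3) J_closed(3) by blast
    then have "f (Suc i) x \<in> J"
      by (rule IH[rotated 2]) (use Suc f_A x in auto)
    then have "(e ^^ Suc s) (f (Suc i) x) \<in> J"
      by (rule pow_J)
    then have "?c *\<^sub>R (e ^^ s) x \<in> J"
      using 1 J_cancel by blast
    then have "(e ^^ s) x \<in> J"
      using c J_scaleD by blast
    then show ?case
      using Suc by auto
  qed auto
qed

text \<open>The iterate f^k on degree \<open>j\<close>, written as a recursion because the member of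
  the family \<open>f\<close> changes with the degree.\<close>

primrec descend :: "nat \<Rightarrow> nat \<Rightarrow> 'a \<Rightarrow> 'a" where
  "descend j 0 y = y"
| "descend j (Suc k) y = f (j - k) (descend j k y)"

lemma descend_A: "y \<in> A j \<Longrightarrow> k \<le> j \<Longrightarrow> descend j k y \<in> A (j - k)"
proof (induction k)
  case (Suc k)
  then have y: "descend j k y \<in> A (j - k)" and jk: "j - k = Suc (j - Suc k)"
    by auto
  from f_A[OF y[unfolded jk]] show ?case
    unfolding descend.simps jk[symmetric] .
qed simp

text \<open>For a highest weight vector \<open>y\<close> the constant is the sum of the weights
  \<open>2 (j - t) - d\<close> for t = 0, ..., k that \<open>e\<close> picks up on its way through
  \<open>Suc k\<close> copies of \<open>f\<close>.\<close>

lemma raise_descend: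
  assumes "y \<in> A j" and "e y \<in> J"
  shows "k < j \<Longrightarrow> e (descend j (Suc k) y)
    - (real (Suc k) * (2 * real j - real d - real k)) *\<^sub>R descend j k y \<in> J"
proof (induction k)
  case 0
  have "f (Suc j) (e y) \<in> J"
    using f_J assms e_A by blast
  then show ?case
    using J_closed(1)[OF commutator[OF assms(1)] \<open>f (Suc j) (e y) \<in> J\<close>] by (simp add: algebra_simps)
next
  case (Suc k)
  let ?c = "real (Suc k) * (2 * real j - real d - real k)"
  let ?z = "descend j (Suc k) y"
  have z: "?z \<in> A (j - Suc k)"
    by (rule descend_A[OF assms(1)]) (use Suc in simp)
  have 1: "e (descend j (Suc (Suc k)) y) - f (Suc (j - Suc k)) (e ?z)
      - (2 * real (j - Suc k) - real d) *\<^sub>R ?z \<in> J"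
    using commutator[OF z] by simp
  have jk: "Suc (j - Suc k) = j - k"
    using Suc by simp
  have "e ?z - ?c *\<^sub>R descend j k y \<in> A (j - k)"
    using e_A[OF z] descend_A[OF assms(1), of k] Suc unfolding jk by (intro A_closed) auto
  then have "f (j - k) (e ?z - ?c *\<^sub>R descend j k y) \<in> J"
    using f_J Suc by simp
  then have 2: "f (j - k) (e ?z) - ?c *\<^sub>R ?z \<in> J"
    by (simp add: linear_diff[OF linear_f] linear_scale[OF linear_f])
  have c: "real (Suc (Suc k)) * (2 * real j - real d - real (Suc k)) = ?c + (2 * real (j - Suc k) - real d)"
    using Suc by (simp add: of_nat_diff algebra_simps)
  show ?case
    using J_closed(1)[OF 1 2] unfolding c jk scaleR_add_left by (simp add: algebra_simps)
qed

text \<open>The constant is the product of the factors (t+1)(2j-d-t) of \<open>raise_descend\<close>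
  over t < k. The bound k \<le> 2j - d keeps every factor positive.\<close>

lemma primitive_in_image:
  assumes "y \<in> A j" and "e y \<in> J"
  shows "d + k \<le> 2 * j \<Longrightarrow> k \<le> j \<Longrightarrow> \<exists>c. c \<noteq> 0 \<and> (e ^^ k) (descend j k y) - c *\<^sub>R y \<in> J"
proof (induction k)
  case 0
  show ?case
    by (intro exI[of _ 1]) (simp add: J_closed)
next
  case (Suc k)
  then obtain c where c: "c \<noteq> 0" "(e ^^ k) (descend j k y) - c *\<^sub>R y \<in> J"
    by auto
  let ?c = "real (Suc k) * (2 * real j - real d - real k)"
  have c': "?c \<noteq> 0"
    using Suc.prems by simp
  have 1: "(e ^^ k) (e (descend j (Suc k) y)) - ?c *\<^sub>R (e ^^ k) (descend j k y) \<in> J"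
    using pow_J[OF raise_descend[OF assms, of k], of k] Suc by (simp add: pow_simps del: descend.simps)
  have 2: "?c *\<^sub>R (e ^^ k) (descend j k y) - (?c * c) *\<^sub>R y \<in> J"
    using J_closed(3)[OF c(2), of ?c] by (simp add: scaleR_diff_right)
  show ?case
    using J_trans[OF 1 2] c c' unfolding pow_Suc2 by (intro exI[of _ "?c * c"]) auto
qed

text \<open>Induction downwards from the top degree: \<open>y\<close> is split into a part in the
  image of \<open>e\<close>, found from a preimage of \<open>e y\<close> one degree higher, and a
  highest weight vector, which \<open>primitive_in_image\<close> handles.\<close>

lemma surjective_mod:
  "2 * i \<le> d \<Longrightarrow> y \<in> A (d - i) \<Longrightarrow> \<exists>x\<in>A i. (e ^^ (d - 2 * i)) x - y \<in> J"
proof (induction i arbitrary: y)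
  case 0
  have "e y \<in> J"
    using e_A[OF 0(2)] top_degree[of "Suc d"] by auto
  from primitive_in_image[OF _ this, of d]
  obtain c where c: "c \<noteq> 0" "(e ^^ d) (descend d d y) - c *\<^sub>R y \<in> J"
    using 0 by auto
  have "(e ^^ d) (inverse c *\<^sub>R descend d d y) - y \<in> J"
    using J_closed(3)[OF c(2), of "inverse c"] c(1) by (simp add: pow_simps scaleR_diff_right)
  then show ?case
    using descend_A[of y d d] 0 by (intro bexI[of _ "inverse c *\<^sub>R descend d d y"] A_closed) auto
next
  case (Suc i)
  define j where "j = d - Suc i"
  have j: "Suc j = d - i" "j - (d - 2 * Suc i) = Suc i"
    using Suc by (auto simp: j_def)
  have y: "y \<in> A j"
    using Suc by (simp add: j_def)
  obtain z where z: "z \<in> A i" "(e ^^ (d - 2 * i)) z - e y \<in> J"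
    using Suc.IH[of "e y"] e_A[OF y] j Suc by auto
  \<comment> \<open>Since \<open>e y\<close> is congruent to e^(d-2i) z, subtracting e^(d-2i-1) z
    leaves an element that \<open>e\<close> sends into \<open>J\<close>.\<close>
  define y0 where "y0 = y - (e ^^ (d - 2 * i - 1)) z"
  have "(e ^^ (d - 2 * i - 1)) z \<in> A j"
    by (rule pow_A'[OF z(1)]) (use Suc in \<open>simp add: j_def\<close>)
  then have y0: "y0 \<in> A j"
    using y by (simp add: y0_def A_closed)
  have "e ((e ^^ (d - 2 * i - 1)) z) = (e ^^ (d - 2 * i)) z"
    using Suc.prems funpow.simps(2)[of "d - 2 * i - 1" e] by (simp add: Suc_diff_Suc)
  then have "e y0 \<in> J"
    using J_closed(5)[OF z(2)] by (simp add: y0_def e_simps)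
  moreover have "d + (d - 2 * Suc i) \<le> 2 * j" "d - 2 * Suc i \<le> j"
    using Suc.prems by (auto simp: j_def)
  ultimately obtain c where c: "c \<noteq> 0" "(e ^^ (d - 2 * Suc i)) (descend j (d - 2 * Suc i) y0) - c *\<^sub>R y0 \<in> J"
    using primitive_in_image[OF y0, of "d - 2 * Suc i"] by blast
  \<comment> \<open>The exponent d - 2(i+1) equals 2j - d, the largest one that
    \<open>primitive_in_image\<close> allows in degree \<open>j\<close>. The summand
    \<open>e z\<close> restores the subtracted term.\<close>
  define x where "x = inverse c *\<^sub>R descend j (d - 2 * Suc i) y0 + e z"
  have "descend j (d - 2 * Suc i) y0 \<in> A (Suc i)"
    using descend_A[OF y0, of "d - 2 * Suc i"] Suc.prems j(2) by (simp add: j_def)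
  then have "x \<in> A (Suc i)"
    using e_A[OF z(1)] by (simp add: x_def A_closed)
  moreover have "(e ^^ (d - 2 * Suc i)) (e z) = (e ^^ (d - 2 * i - 1)) z"
    unfolding pow_Suc2 using Suc.prems by (simp add: Suc_diff_Suc del: funpow.simps)
  then have "(e ^^ (d - 2 * Suc i)) x - y \<in> J"
    using J_closed(3)[OF c(2), of "inverse c"] c(1)
    by (simp add: x_def y0_def pow_simps scaleR_diff_right algebra_simps del: funpow.simps)
  ultimately show ?case
    by blast
qed

theorem lefschetz_if_lowering: lefschetz
  unfolding lefschetz_def
proof (intro allI impI conjI ballI)
  show "x \<in> J" if "2 * i \<le> d" "x \<in> A i" "(e ^^ (d - 2 * i)) x \<in> J" for i x
    using injective_mod[OF that(2) _ that(3)] that(1) by simp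
qed (rule surjective_mod)

end

section \<open>A lowering operator from the hard Lefschetz property\<close>

text \<open>Preimages are chosen on a basis of \<open>S\<close> and extended linearly. This supplies
  a linear inverse of a power of \<open>e\<close> modulo \<open>J\<close> without forming the
  quotient space.\<close>

lemma linear_choice:
  fixes u :: "'a \<Rightarrow> 'a"
  assumes S: "subspace S" and T: "subspace T" and u: "linear u"
    and surj: "\<And>y. y \<in> S \<Longrightarrow> \<exists>x\<in>T. u x - y \<in> J"
  shows "\<exists>g. linear g \<and> (\<forall>y\<in>S. g y \<in> T \<and> u (g y) - y \<in> J)"
proof -
  obtain B where B: "B \<subseteq> S" "independent B" "S \<subseteq> span B"
    by (rule maximal_independent_subset)
  have "\<forall>b\<in>B. \<exists>x. x \<in> T \<and> u x - b \<in> J"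
    using surj B(1) by auto
  from bchoice[OF this] obtain c where c: "\<And>b. b \<in> B \<Longrightarrow> c b \<in> T \<and> u (c b) - b \<in> J"
    by auto
  obtain g where g: "linear g" "\<And>b. b \<in> B \<Longrightarrow> g b = c b"
    using linear_independent_extend[OF B(2), of c] by auto
  have "g y \<in> T \<and> u (g y) - y \<in> J" if "y \<in> span B" for y
    using that
  proof (induction rule: span_induct_alt)
    case base
    have "g 0 = 0" "u 0 = 0"
      using linear_0 g(1) u by blast+
    then show ?case
      using subspace_0[OF T] J_closed(4) by simp
  next
    case (step r b y)
    have "u (g (r *\<^sub>R b + y)) - (r *\<^sub>R b + y) = r *\<^sub>R (u (g b) - b) + (u (g y) - y)"
      by (simp add: linear_add[OF g(1)] linear_scale[OF g(1)] linear_add[OF u] linear_scale[OF u]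
          scaleR_diff_right)
    moreover have "g (r *\<^sub>R b + y) = r *\<^sub>R g b + g y"
      by (simp add: linear_add[OF g(1)] linear_scale[OF g(1)])
    moreover have "g b \<in> T" "u (g b) - b \<in> J"
      using c[of b] g(2)[of b] step by simp_all
    ultimately show ?case
      using step subspace_add[OF T] subspace_scale[OF T] J_closed(1,3) by metis
  qed
  then show ?thesis
    using g(1) B(3) by blast
qed

text \<open>Every \<open>x\<close> of degree \<open>j \<le> d / 2\<close> is \<open>p + e y\<close> with \<open>p\<close> primitive, that is \<open>e\<^bsup>d-2j+1\<^esup> p = 0\<close>,
  and the inverse \<open>g\<^sub>i\<close> of \<open>e\<^bsup>d-2i\<^esup>\<close> gives \<open>y = g\<^bsub>j-1\<^esub> (e\<^bsup>d-2j+1\<^esup> x)\<close>. A lowering operator that kills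
  the primitive elements is forced to be \<open>f x = e (f y) - (2(j-1)-d) y\<close>; above the middle degree
  it is forced by \<open>f (e\<^sup>s x) = e\<^sup>s (f x) + s e\<^bsup>s-1\<^esup> x\<close> for \<open>x\<close> of degree \<open>i\<close> and \<open>s = d - 2i\<close>.\<close>

context
  fixes g :: "nat \<Rightarrow> 'a \<Rightarrow> 'a"
begin

primrec lower_half :: "nat \<Rightarrow> 'a \<Rightarrow> 'a" where
  "lower_half 0 x = 0"
| "lower_half (Suc j) x = (let y = g j ((e ^^ (d - Suc (2 * j))) x)
     in e (lower_half j y) - (2 * real j - real d) *\<^sub>R y)"

definition lower_map :: "nat \<Rightarrow> 'a \<Rightarrow> 'a" where
  "lower_map j x = (if d < j then 0 else if 2 * j \<le> d then lower_half j x
     else let y = g (d - j) x; s = 2 * j - d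
       in (e ^^ s) (lower_half (d - j) y) + real s *\<^sub>R (e ^^ (s - 1)) y)"

end

text \<open>The relation to verify is the commutator. Below the middle it holds because the
  recursion for \<open>lower_half\<close> was read off from it. The rest is a comparison of
  preimages: two elements with congruent images under an injective power of \<open>e\<close> are
  congruent, and all operators respect \<open>J\<close>.\<close>

theorem lowering_if_lefschetz:
  assumes "lefschetz"
  shows "\<exists>f. lowering f"
proof -
  have inj: "x \<in> J" if "2 * i \<le> d" "x \<in> A i" "(e ^^ (d - 2 * i)) x \<in> J" for x i
    using assms that by (auto simp: lefschetz_def)
  have "\<exists>g. linear g \<and> (2 * i \<le> d \<longrightarrow> (\<forall>y\<in>A (d - i). g y \<in> A i \<and> (e ^^ (d - 2 * i)) (g y) - y \<in> J))" for i
  proof (cases "2 * i \<le> d")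
    case True
    then show ?thesis
      using linear_choice[OF subspace_A subspace_A linear_pow, of "d - i" i "d - 2 * i"] assms
      unfolding lefschetz_def by simp
  qed (use linearI[of "\<lambda>x :: 'a. 0 :: 'a"] in auto)
  then obtain g where lin_g: "linear (g i)"
    and g_A: "2 * i \<le> d \<Longrightarrow> y \<in> A (d - i) \<Longrightarrow> g i y \<in> A i"
    and g_inv: "2 * i \<le> d \<Longrightarrow> y \<in> A (d - i) \<Longrightarrow> (e ^^ (d - 2 * i)) (g i y) - y \<in> J" for i y
    by metis
  have g_J: "g i y \<in> J" if "2 * i \<le> d" "y \<in> A (d - i)" "y \<in> J" for i y
    using that inj[OF _ g_A] g_inv J_cancel by blast
  have g_unique: "g i y - x \<in> J" if "2 * i \<le> d" "y \<in> A (d - i)" "x \<in> A i"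
    "(e ^^ (d - 2 * i)) x - y \<in> J" for i x y
  proof (rule inj)
    show "(e ^^ (d - 2 * i)) (g i y - x) \<in> J"
      using J_closed(2)[OF g_inv[OF that(1,2)] that(4)] by (simp add: pow_simps)
  qed (use that g_A in \<open>auto simp: A_closed\<close>)
  define h where "h = lower_half g"
  define f where "f = lower_map g"
  have h_Suc: "h (Suc j) x = e (h j (g j ((e ^^ (d - Suc (2 * j))) x)))
      - (2 * real j - real d) *\<^sub>R g j ((e ^^ (d - Suc (2 * j))) x)" for j x
    by (simp add: h_def Let_def)
  have h_0: "h 0 x = 0" for x
    by (simp add: h_def)
  have low_arg: "(e ^^ (d - Suc (2 * j))) x \<in> A (d - j)" if "2 * Suc j \<le> d" "x \<in> A (Suc j)" for j x
    using that by (auto intro!: pow_A')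
  have lin_h: "linear (h j)" for j
  proof (induction j)
    case 0
    show ?case
      by (simp add: h_0 linear_iff)
  next
    case (Suc j)
    show ?case
      unfolding linear_iff
      by (simp add: h_Suc linear_add[OF Suc] linear_add[OF lin_g] linear_scale[OF Suc]
          linear_scale[OF lin_g] e_simps pow_simps algebra_simps)
  qed
  have h_A: "h (Suc j) x \<in> A j" if "2 * Suc j \<le> d" "x \<in> A (Suc j)" for j x
    using that
  proof (induction j arbitrary: x)
    case 0
    then show ?case
      using g_A[OF _ low_arg[OF 0]] by (simp add: h_Suc h_0 e_simps A_closed)
  next
    case (Suc j)
    have "g (Suc j) ((e ^^ (d - Suc (2 * Suc j))) x) \<in> A (Suc j)"
      using g_A[OF _ low_arg[OF Suc.prems]] Suc.prems by simp
    then show ?case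
      using Suc unfolding h_Suc[of "Suc j"] by (intro A_closed(2,3) e_A) auto
  qed
  have h_J: "h j x \<in> J" if "2 * j \<le> d" "x \<in> A j" "x \<in> J" for j x
    using that
  proof (induction j arbitrary: x)
    case (Suc j)
    have "g j ((e ^^ (d - Suc (2 * j))) x) \<in> A j \<inter> J"
      using g_A[OF _ low_arg[OF Suc.prems(1,2)]] g_J[OF _ low_arg[OF Suc.prems(1,2)]] pow_J Suc.prems
      by simp
    then show ?case
      using Suc unfolding h_Suc by (intro J_closed(2,3) e_J) auto
  qed (simp add: h_0 J_closed)
  have h_comm: "e (h j x) - h (Suc j) (e x) - (2 * real j - real d) *\<^sub>R x \<in> J"
    if "2 * Suc j \<le> d" "x \<in> A j" for j x
  proof -
    have dj: "d - 2 * j = Suc (d - Suc (2 * j))"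
      using that by simp
    \<comment> \<open>This is \<open>g j\<close> applied to e^(d-2j) x, hence congruent to
      \<open>x\<close> by \<open>g_unique\<close>. Replacing \<open>y\<close> by \<open>x\<close> in
      the recursion for \<open>h\<close> gives the commutator.\<close>
    define y where "y = g j ((e ^^ (d - Suc (2 * j))) (e x))"
    have yx: "y - x \<in> J" "y \<in> A j"
      unfolding y_def using low_arg[OF that(1) e_A[OF that(2)]] that
      by (auto intro!: g_unique g_A simp: dj pow_Suc2 J_closed simp del: funpow.simps)
    have "h j (y - x) \<in> J"
      using h_J that yx A_closed by simp
    then have 1: "e (h j x) - e (h j y) \<in> J"
      using e_J[of "h j (y - x)"] J_closed(5)[of "e (h j y) - e (h j x)"]
      by (simp add: linear_diff[OF lin_h] e_simps)
    have 2: "(2 * real j - real d) *\<^sub>R (y - x) \<in> J"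
      using yx J_closed by blast
    have hx: "h (Suc j) (e x) = e (h j y) - (2 * real j - real d) *\<^sub>R y"
      by (simp add: h_Suc y_def)
    show ?thesis
      using J_closed(1)[OF 1 2] unfolding hx by (simp add: algebra_simps)
  qed
  have f_low: "2 * j \<le> d \<Longrightarrow> f j x = h j x" for j x
    by (simp add: f_def lower_map_def h_def)
  have f_high: "f j x = (e ^^ (2 * j - d)) (h (d - j) (g (d - j) x))
      + real (2 * j - d) *\<^sub>R (e ^^ (2 * j - d - 1)) (g (d - j) x)" if "d < 2 * j" "j \<le> d" for j x
    using that by (simp add: f_def lower_map_def h_def Let_def)
  have f_top: "d < j \<Longrightarrow> f j x = 0" for j x
    by (simp add: f_def lower_map_def)
  have high: "2 * (d - j) \<le> d" "d - (d - j) = j" "d - 2 * (d - j) = 2 * j - d" if "d < 2 * j" "j \<le> d" for j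
    using that by auto
  have "linear (f j)" for j
  proof -
    consider "d < j" | "2 * j \<le> d" | "d < 2 * j" "j \<le> d"
      by linarith
    then show ?thesis
    proof cases
      case 3
      then show ?thesis
        unfolding linear_iff
        by (simp add: f_high linear_add[OF lin_h] linear_add[OF lin_g] linear_scale[OF lin_h]
          linear_scale[OF lin_g] pow_simps algebra_simps)
    qed (simp_all add: f_top f_low linear_iff linear_add[OF lin_h] linear_scale[OF lin_h])
  qed
  moreover have "f 0 x = 0" for x
    using f_low[of 0] by (simp add: h_0)
  moreover have "f (Suc j) x \<in> A j" if x: "x \<in> A (Suc j)" for j x
  proof -
    consider "d < Suc j" | "2 * Suc j \<le> d" | "d < 2 * Suc j" "Suc j \<le> d"
      by linarith
    then show ?thesis
    proof cases
      case 3
      have gx: "g (d - Suc j) x \<in> A (d - Suc j)"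
        using g_A[OF high(1)[OF 3]] x high(2)[OF 3] by simp
      have "(e ^^ (2 * Suc j - d - 1)) (g (d - Suc j) x) \<in> A j"
        by (rule pow_A'[OF gx]) (use 3 in auto)
      moreover have "(e ^^ (2 * Suc j - d)) (h (d - Suc j) (g (d - Suc j) x)) \<in> A j"
      proof (cases "d - Suc j")
        case 0
        then show ?thesis
          by (simp add: h_0 pow_simps A_closed e_simps)
      next
        case (Suc i)
        have "h (Suc i) (g (Suc i) x) \<in> A i"
          using h_A[of i] gx high(1)[OF 3] Suc by simp
        then show ?thesis
          unfolding Suc by (rule pow_A') (use 3 Suc in auto)
      qed
      ultimately show ?thesis
        unfolding f_high[OF 3] by (intro A_closed(1,3))
    qed (use f_top f_low h_A x A_closed in auto)
  qed
  moreover have "f j x \<in> J" if x: "x \<in> A j" "x \<in> J" for j x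
  proof -
    consider "d < j" | "2 * j \<le> d" | "d < 2 * j" "j \<le> d"
      by linarith
    then show ?thesis
    proof cases
      case 3
      have "g (d - j) x \<in> A (d - j)" "g (d - j) x \<in> J"
        using g_A[OF high(1)[OF 3]] g_J[OF high(1)[OF 3]] x high(2)[OF 3] by simp_all
      then show ?thesis
        using h_J high(1)[OF 3] unfolding f_high[OF 3] by (intro J_closed(1,3) pow_J) auto
    qed (use f_top f_low h_J x J_closed in auto)
  qed
  moreover have "e (f j x) - f (Suc j) (e x) - (2 * real j - real d) *\<^sub>R x \<in> J" if x: "x \<in> A j" for j x
  proof -
    consider "d < j" | "2 * Suc j \<le> d" | "d < 2 * Suc j" "j \<le> d"
      by linarith
    then show ?thesis
    proof cases
      case 1
      then show ?thesis
        using J_closed(5)[OF J_closed(3)[of x]] x top_degree[OF 1] by (auto simp: f_top e_simps)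
    next
      case 2
      then show ?thesis
        using h_comm[OF 2 x] by (simp add: f_low)
    next
      case 3
      show ?thesis
      proof (cases "d = 2 * j + 1")
        case True
        \<comment> \<open>Here \<open>e\<close> crosses the middle: \<open>f\<close> is
          \<open>h\<close> in degree \<open>j\<close> but has the upper form in degree
          \<open>Suc j\<close>, with s = 1. Its second term supplies the weight -1.\<close>
        define x' where "x' = g j (e x)"
        have x': "x' - x \<in> J" "x' \<in> A j"
          unfolding x'_def using e_A[OF x] x True
          by (auto intro!: g_unique g_A simp: J_closed)
        have "h j (x' - x) \<in> J"
          using h_J x' x A_closed True by simp
        then have 1: "e (h j x') - e (h j x) \<in> J"
          using e_J[of "h j (x' - x)"] by (simp add: linear_diff[OF lin_h] e_simps)
        have eq1: "f (Suc j) (e x) = e (h j x') + x'"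
          using f_high[of "Suc j" "e x"] True by (simp add: x'_def)
        have eq2: "f j x = h j x"
          using f_low True by simp
        have eq3: "2 * real j - real d = - 1"
          using True by simp
        show ?thesis
          using J_closed(5)[OF J_closed(1)[OF 1 x'(1)]] unfolding eq1 eq2 eq3 by (simp add: algebra_simps)
      next
        case False
        define i s where "i = d - j" and "s = 2 * j - d"
        have nums: "2 * i \<le> d" "d - i = j" "d - 2 * i = s" "real s = 2 * real j - real d"
          using 3 False by (auto simp: i_def s_def)
        \<comment> \<open>This unifies the middle degree with the degrees above it. For s = 0 the
          definition uses \<open>lower_half\<close> on \<open>x\<close> itself, so \<open>x\<close>
          serves as its own preimage; otherwise the preimage is \<open>g i x\<close>.\<close>
        have "\<exists>x'. x' \<in> A i \<and> (e ^^ s) x' - x \<in> J \<and>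
          f j x = (e ^^ s) (h i x') + real s *\<^sub>R (e ^^ (s - 1)) x'"
        proof (cases "s = 0")
          case True
          then have "i = j"
            using nums by simp
          then show ?thesis
            unfolding \<open>s = 0\<close> using x nums(1) f_low J_closed(4) by (intro exI[of _ x]) auto
        next
          case False
          then show ?thesis
            using f_high[of j x] g_A[OF nums(1), of x] g_inv[OF nums(1), of x] x 3
            unfolding nums(2,3) by (intro exI[of _ "g i x"]) (auto simp: i_def s_def)
        qed
        then obtain x' where x': "x' \<in> A i" "(e ^^ s) x' - x \<in> J"
          and fx: "f j x = (e ^^ s) (h i x') + real s *\<^sub>R (e ^^ (s - 1)) x'"
          by blast
        have "real s *\<^sub>R e ((e ^^ (s - 1)) x') = real s *\<^sub>R (e ^^ s) x'"
          by (cases s) auto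
        then have efx: "e (f j x) = (e ^^ Suc s) (h i x') + real s *\<^sub>R (e ^^ s) x'"
          by (simp add: fx e_simps)
        have sx: "real s *\<^sub>R (e ^^ s) x' - real s *\<^sub>R x \<in> J"
          using J_closed(3)[OF x'(2)] by (simp add: scaleR_diff_right)
        show ?thesis
        proof (cases "j = d")
          \<comment> \<open>In the top degree \<open>f (Suc j)\<close> is zero and \<open>x'\<close>
            has degree 0, where \<open>h\<close> vanishes. What remains of e (f x) is s x, and s = d
            is the weight.\<close>
          case True
          then have "i = 0"
            by (simp add: i_def)
          then show ?thesis
            using sx True unfolding efx nums(4)[symmetric] by (simp add: f_top h_0 pow_simps e_simps)
        next
          case False
          define k where "k = d - Suc j"
          have k: "i = Suc k" "2 * k \<le> d" "d - k = Suc j" "d - 2 * k = Suc (Suc s)"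
            "d - Suc (2 * k) = Suc s" "real d - 2 * real k = real s + 2"
            using False 3 nums by (auto simp: k_def)
          \<comment> \<open>Unfolding \<open>h\<close> at \<open>x'\<close> produces
            \<open>y\<close>, and the definition of \<open>f\<close> at \<open>e x\<close> produces
            \<open>y'\<close>. Since e^(s+1) x' is congruent to \<open>e x\<close>, so are
            \<open>y\<close> and \<open>y'\<close>; the terms with factor s + 2 cancel and s x is
            left.\<close>
          define y y' where "y = g k ((e ^^ Suc s) x')" and "y' = g k (e x)"
          have "(e ^^ Suc s) x' \<in> A (d - k)"
            by (rule pow_A'[OF x'(1)]) (use k nums in auto)
          moreover have "e x \<in> A (d - k)"
            using e_A[OF x] k by simp
          moreover have "(e ^^ Suc s) x' - e x \<in> J"
            using e_J[OF x'(2)] by (simp add: e_simps)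
          ultimately have "y \<in> A k" "y' \<in> A k" "y - y' \<in> J" and y: "(e ^^ Suc (Suc s)) y - (e ^^ Suc s) x' \<in> J"
            using g_A[OF k(2)] g_J[OF k(2), of "(e ^^ Suc s) x' - e x"] g_inv[OF k(2)] k(4) A_closed
            by (auto simp: y_def y'_def linear_diff[OF lin_g] simp del: funpow.simps)
          then have "h k (y - y') \<in> J"
            using h_J k(2) A_closed by blast
          then have 1: "(e ^^ Suc (Suc s)) (h k y) - (e ^^ Suc (Suc s)) (h k y') \<in> J"
            using pow_J[of "h k (y - y')" "Suc (Suc s)"]
            by (simp add: linear_diff[OF lin_h] pow_simps del: funpow.simps)
          have 2: "(real s + 2) *\<^sub>R (e ^^ Suc s) y - (real s + 2) *\<^sub>R (e ^^ Suc s) y' \<in> J"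
            using J_closed(3)[OF pow_J[OF \<open>y - y' \<in> J\<close>, of "Suc s"]]
            by (simp add: pow_simps scaleR_diff_right del: funpow.simps)
          have "f (Suc j) (e x) = (e ^^ Suc (Suc s)) (h k y') + (real s + 2) *\<^sub>R (e ^^ Suc s) y'"
          proof -
            have "2 * Suc j - d = Suc (Suc s)" "Suc (Suc s) - 1 = Suc s" "d - Suc j = k"
              "real (Suc (Suc s)) = real s + 2"
              using False 3 nums by (auto simp: s_def k_def)
            then show ?thesis
              using f_high[of "Suc j" "e x"] False 3 unfolding y'_def by simp
          qed
          moreover have "(e ^^ Suc s) (h i x') = (e ^^ Suc (Suc s)) (h k y) + (real s + 2) *\<^sub>R (e ^^ Suc s) y"
          proof -
            have "h i x' = e (h k y) + (real s + 2) *\<^sub>R y"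
              unfolding k(1) h_Suc k(5) y_def[symmetric] k(6)[symmetric] by (simp add: algebra_simps)
            then show ?thesis
              by (simp only: pow_simps pow_Suc2)
          qed
          ultimately show ?thesis
            using J_closed(1)[OF J_closed(1)[OF 1 2] sx] unfolding efx nums(4)[symmetric]
            by (simp add: algebra_simps del: funpow.simps)
        qed
      qed
    qed
  qed
  ultimately have "lowering f"
    by (auto simp: lowering_def)
  then show ?thesis
    by blast
qed

end

section \<open>Polynomials as a real vector space\<close>

text \<open>As instances of \<open>real_vector\<close>, polynomials have the spans, bases and linear
  maps on which the locale \<open>graded_quotient\<close> relies.\<close>

instantiation poly_mapping :: (type, real_vector) real_vector
begin

definition scaleR_poly_mapping :: "real \<Rightarrow> ('a \<Rightarrow>\<^sub>0 'b) \<Rightarrow> 'a \<Rightarrow>\<^sub>0 'b" where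
  "scaleR_poly_mapping r = Poly_Mapping.map (scaleR r)"

lemma lookup_scaleR: "Poly_Mapping.lookup (r *\<^sub>R p) k = r *\<^sub>R Poly_Mapping.lookup p k"
  for p :: "'a \<Rightarrow>\<^sub>0 'b"
  by (simp add: scaleR_poly_mapping_def map.rep_eq when_def)

instance
  by standard (auto intro!: poly_mapping_eqI simp: lookup_scaleR lookup_add algebra_simps)

end

abbreviation mon :: "('v \<Rightarrow>\<^sub>0 nat) \<Rightarrow> 'v mpoly" where
  "mon m \<equiv> Poly_Mapping.single m 1"

definition polys :: "'v set \<Rightarrow> 'v mpoly set" where
  "polys V = {p. \<forall>m\<in>Poly_Mapping.keys p. Poly_Mapping.keys m \<subseteq> V}"

definition mdeg :: "('v \<Rightarrow>\<^sub>0 nat) \<Rightarrow> nat" where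
  "mdeg m = (\<Sum>v\<in>Poly_Mapping.keys m. Poly_Mapping.lookup m v)"

definition linext :: "(('v \<Rightarrow>\<^sub>0 nat) \<Rightarrow> 'b::real_vector) \<Rightarrow> 'v mpoly \<Rightarrow> 'b" where
  "linext \<phi> p = (\<Sum>m\<in>Poly_Mapping.keys p. Poly_Mapping.lookup p m *\<^sub>R \<phi> m)"

lemma scaleR_eq_pconst: "r *\<^sub>R p = pconst r * p" for p :: "'v mpoly"
proof -
  have "scaleR r = (*) r"
    by (simp add: fun_eq_iff)
  then show ?thesis
    by (simp add: scaleR_poly_mapping_def pconst_def mult_map_scale_conv_mult)
qed

lemma scaleR_mult_left: "(r *\<^sub>R p) * q = r *\<^sub>R (p * q)" for p q :: "'v mpoly"
  by (simp add: scaleR_eq_pconst algebra_simps)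

lemma scaleR_mult_right: "p * (r *\<^sub>R q) = r *\<^sub>R (p * q)" for p q :: "'v mpoly"
  by (simp add: scaleR_eq_pconst algebra_simps)

lemma linear_mult: "linear ((*) p)" for p :: "'v mpoly"
  by (rule linearI) (simp_all add: algebra_simps scaleR_mult_right)

lemma mon_mult: "mon m * mon n = mon (m + n)"
  by (simp add: mult_single)

lemma linext_superset:
  assumes "finite S" and "Poly_Mapping.keys p \<subseteq> S"
  shows "linext \<phi> p = (\<Sum>m\<in>S. Poly_Mapping.lookup p m *\<^sub>R \<phi> m)"
  unfolding linext_def by (rule sum.mono_neutral_left) (use assms in \<open>auto simp: in_keys_iff\<close>)

lemma linear_linext: "linear (linext \<phi>)"
proof (rule linearI)
  fix p q :: "'a mpoly"
  let ?S = "Poly_Mapping.keys p \<union> Poly_Mapping.keys q"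
  show "linext \<phi> (p + q) = linext \<phi> p + linext \<phi> q"
    using linext_superset[of ?S "p + q" \<phi>] linext_superset[of ?S p \<phi>] linext_superset[of ?S q \<phi>]
      Poly_Mapping.keys_add[of p q]
    by (simp add: lookup_add scaleR_add_left sum.distrib)
next
  fix r and p :: "'a mpoly"
  show "linext \<phi> (r *\<^sub>R p) = r *\<^sub>R linext \<phi> p"
  proof -
    have "Poly_Mapping.keys (r *\<^sub>R p) \<subseteq> Poly_Mapping.keys p"
      by (auto simp: in_keys_iff lookup_scaleR)
    then show ?thesis
      using linext_superset[of "Poly_Mapping.keys p" "r *\<^sub>R p" \<phi>]
      by (simp add: linext_def[of \<phi> p] lookup_scaleR scaleR_sum_right)
  qed
qed

lemma linext_mon [simp]: "linext \<phi> (mon m) = \<phi> m"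
  by (simp add: linext_def)

lemma linext_expansion: "linext mon p = p"
proof (rule poly_mapping_eqI)
  fix k
  have "Poly_Mapping.lookup (linext mon p) k =
      (\<Sum>m\<in>Poly_Mapping.keys p. Poly_Mapping.lookup p m * (if m = k then 1 else 0))"
    by (simp add: linext_def lookup_sum lookup_scaleR lookup_single when_def)
  also have "\<dots> = Poly_Mapping.lookup p k"
    by (simp add: in_keys_iff if_distrib cong: if_cong)
  finally show "Poly_Mapping.lookup (linext mon p) k = Poly_Mapping.lookup p k" .
qed

lemma in_span_mon_iff: "p \<in> span (mon ` M) \<longleftrightarrow> Poly_Mapping.keys p \<subseteq> M"
proof
  assume "p \<in> span (mon ` M)"
  then show "Poly_Mapping.keys p \<subseteq> M"
  proof (induction rule: span_induct_alt)
    case (step c x y)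
    then show ?case
      using Poly_Mapping.keys_add[of "c *\<^sub>R x" y] by (auto simp: in_keys_iff lookup_scaleR lookup_add lookup_single when_def split: if_splits)
  qed simp
next
  assume "Poly_Mapping.keys p \<subseteq> M"
  then have "linext mon p \<in> span (mon ` M)"
    unfolding linext_def by (intro span_sum span_scale span_base) auto
  then show "p \<in> span (mon ` M)"
    by (simp add: linext_expansion)
qed

lemma carrier_poly_ring: "carrier (poly_ring V) = polys V"
  by (simp add: poly_ring_def polys_def)

lemma polys_eq_span: "polys V = span (mon ` {m. Poly_Mapping.keys m \<subseteq> V})"
  by (auto simp: polys_def in_span_mon_iff subset_iff)

lemma homogeneous_polys_eq_span:
  "homogeneous_polys V i = span (mon ` {m. Poly_Mapping.keys m \<subseteq> V \<and> mdeg m = i})"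
  by (auto simp: homogeneous_polys_def carrier_poly_ring polys_def mdeg_def set_eq_iff in_span_mon_iff subset_iff)

lemma mon_in_polys: "Poly_Mapping.keys m \<subseteq> V \<Longrightarrow> mon m \<in> polys V"
  by (simp add: polys_def)

lemma mon_in_homogeneous_polys:
  "Poly_Mapping.keys m \<subseteq> V \<Longrightarrow> mdeg m = i \<Longrightarrow> mon m \<in> homogeneous_polys V i"
  by (auto simp: homogeneous_polys_eq_span intro: span_base)

lemma subspace_polys: "subspace (polys V)"
  by (simp add: polys_eq_span)

lemma subspace_homogeneous_polys: "subspace (homogeneous_polys V i)"
  by (simp add: homogeneous_polys_eq_span)

lemma homogeneous_polys_subset: "homogeneous_polys V i \<subseteq> polys V"
  by (auto simp: homogeneous_polys_def carrier_poly_ring)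

lemma polys_mono: "V \<subseteq> W \<Longrightarrow> polys V \<subseteq> polys W"
  by (auto simp: polys_def)

lemma homogeneous_polys_mono: "V \<subseteq> W \<Longrightarrow> homogeneous_polys V i \<subseteq> homogeneous_polys W i"
  by (auto simp: homogeneous_polys_def carrier_poly_ring polys_def)

lemma polys_mult: "p \<in> polys V \<Longrightarrow> q \<in> polys V \<Longrightarrow> p * q \<in> polys V"
  using cring.cring_simprules(5)[OF cring_poly_ring[of V], of p q]
  unfolding carrier_poly_ring by (simp add: poly_ring_def)

lemma keys_madd: "Poly_Mapping.keys (m + n) = Poly_Mapping.keys m \<union> Poly_Mapping.keys n"
  for m n :: "'v \<Rightarrow>\<^sub>0 nat"
  by (auto simp: in_keys_iff lookup_add)

lemma mdeg_superset:
  "finite S \<Longrightarrow> Poly_Mapping.keys m \<subseteq> S \<Longrightarrow> mdeg m = (\<Sum>v\<in>S. Poly_Mapping.lookup m v)"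
  unfolding mdeg_def by (rule sum.mono_neutral_left) (auto simp: in_keys_iff)

lemma mdeg_add: "mdeg (m + n) = mdeg m + mdeg n"
  using mdeg_superset[of "Poly_Mapping.keys (m + n)" m] mdeg_superset[of "Poly_Mapping.keys (m + n)" n]
  by (simp add: mdeg_def[of "m + n"] lookup_add sum.distrib keys_madd)

lemma mdeg_0 [simp]: "mdeg 0 = 0"
  by (simp add: mdeg_def)

lemma span_mult_closed:
  fixes p q :: "'v mpoly"
  assumes "p \<in> span S" and "q \<in> span T" and "\<And>x y. x \<in> S \<Longrightarrow> y \<in> T \<Longrightarrow> x * y \<in> U"
    and "subspace U"
  shows "p * q \<in> U"
proof -
  have 1: "x * q \<in> U" if "x \<in> S" for x
    using assms(2)
  proof (induction rule: span_induct_alt)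
    case base
    show ?case
      using assms(4) by (simp add: subspace_0)
  next
    case (step c y z)
    then show ?case
      using assms(3)[OF that] assms(4)
      by (simp add: distrib_left scaleR_mult_right subspace_add subspace_scale)
  qed
  show ?thesis
    using assms(1)
  proof (induction rule: span_induct_alt)
    case base
    show ?case
      using assms(4) by (simp add: subspace_0)
  next
    case (step c y z)
    then show ?case
      using 1 assms(4)
      by (simp add: distrib_right scaleR_mult_left subspace_add subspace_scale)
  qed
qed

lemma homogeneous_polys_mult:
  assumes "p \<in> homogeneous_polys V i" and "q \<in> homogeneous_polys W j"
    and "V \<subseteq> U" and "W \<subseteq> U" and "k = i + j"
  shows "p * q \<in> homogeneous_polys U k"
  using assms(1,2) unfolding homogeneous_polys_eq_span[of V] homogeneous_polys_eq_span[of W]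
  by (rule span_mult_closed)
    (use assms(3-) in \<open>auto simp: mon_mult keys_madd mdeg_add subspace_homogeneous_polys subset_iff
      intro!: mon_in_homogeneous_polys\<close>)

lemma homogeneous_polys_power:
  "p \<in> homogeneous_polys V 1 \<Longrightarrow> p ^ n \<in> homogeneous_polys V n"
proof (induction n)
  case 0
  show ?case
    using mon_in_homogeneous_polys[of 0 V 0] by simp
qed (auto intro: homogeneous_polys_mult)

lemma pconst_in_polys: "pconst c \<in> polys V"
  by (auto simp: polys_def pconst_def)

lemma prod_pvar: "finite S \<Longrightarrow> (\<Prod>v\<in>S. pvar v) = mon (\<Sum>v\<in>S. Poly_Mapping.single v 1)"
  by (induction S rule: finite_induct) (simp_all add: pvar_def mon_mult)

lemma keys_sum_single: "finite S \<Longrightarrow> Poly_Mapping.keys (\<Sum>v\<in>S. Poly_Mapping.single v (1::nat)) = S"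
  by (induction S rule: finite_induct) (simp_all add: keys_madd)

section \<open>The defining relations of a reduced face ring\<close>

definition generators :: "'v set \<Rightarrow> 'v set set \<Rightarrow> 'v mpoly list \<Rightarrow> 'v mpoly set" where
  "generators V K \<Theta> = {\<Prod>v\<in>S. pvar v | S. S \<subseteq> V \<and> S \<notin> K} \<union> set \<Theta>"

text \<open>Monomials span the polynomial ring, so this span is the ideal generated by the nonface
  monomials and the parameters. As a linear span it allows induction over combinations of monomial
  multiples of generators.\<close>

definition relations :: "'v set \<Rightarrow> 'v set set \<Rightarrow> 'v mpoly list \<Rightarrow> 'v mpoly set" where
  "relations V K \<Theta> = span {mon m * g | m g. Poly_Mapping.keys m \<subseteq> V \<and> g \<in> generators V K \<Theta>}"

lemma subspace_relations: "subspace (relations V K \<Theta>)"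
  by (simp add: relations_def)

lemma generators_relations: "g \<in> generators V K \<Theta> \<Longrightarrow> g \<in> relations V K \<Theta>"
  unfolding relations_def by (rule span_base) (auto intro!: exI[of _ 0] exI[of _ g])

lemma relations_mult:
  assumes "p \<in> polys V" and "q \<in> relations V K \<Theta>"
  shows "p * q \<in> relations V K \<Theta>"
  using assms unfolding polys_eq_span relations_def
proof (rule span_mult_closed)
  fix x y
  assume "x \<in> mon ` {m. Poly_Mapping.keys m \<subseteq> V}"
    and "y \<in> {mon m * g | m g. Poly_Mapping.keys m \<subseteq> V \<and> g \<in> generators V K \<Theta>}"
  then obtain m n g where "x = mon m" "y = mon n * g" "Poly_Mapping.keys m \<subseteq> V"
    "Poly_Mapping.keys n \<subseteq> V" "g \<in> generators V K \<Theta>"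
    by auto
  moreover have "mon m * (mon n * g) = mon (m + n) * g"
    by (simp add: mon_mult mult.assoc[symmetric])
  ultimately show "x * y \<in> span {mon m * g | m g. Poly_Mapping.keys m \<subseteq> V \<and> g \<in> generators V K \<Theta>}"
    by (intro span_base) (auto intro!: exI[of _ "m + n"] simp: keys_madd)
qed (rule subspace_span)

lemma relations_mult2:
  "q \<in> relations V K \<Theta> \<Longrightarrow> p \<in> polys V \<Longrightarrow> q * p \<in> relations V K \<Theta>"
  using relations_mult[of p V q K \<Theta>] by (simp add: mult.commute)

section \<open>Replacing the twofold quotient by congruence modulo the relations\<close>

locale presentation =
  fixes V :: "'v set" and K :: "'v set set" and \<Theta> :: "'v mpoly list"
  assumes finite_V: "finite V" and params: "set \<Theta> \<subseteq> homogeneous_polys V 1"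
begin

abbreviation "R \<equiv> poly_ring V"
abbreviation "J \<equiv> relations V K \<Theta>"
abbreviation "H \<equiv> reduced_face_ring V K \<Theta>"
abbreviation "\<pi> \<equiv> reduced_class V K \<Theta>"

sublocale R: cring R
  by (rule cring_poly_ring)

lemma R_simps: "p \<oplus>\<^bsub>R\<^esub> q = p + q" "p \<otimes>\<^bsub>R\<^esub> q = p * q" "\<zero>\<^bsub>R\<^esub> = 0" "\<one>\<^bsub>R\<^esub> = 1" "carrier R = polys V"
  by (simp_all add: poly_ring_def polys_def)

lemma R_uminus: "p \<in> polys V \<Longrightarrow> \<ominus>\<^bsub>R\<^esub> p = - p"
  using R.minus_equality[of "- p" p] subspace_neg[OF subspace_polys[of V]] by (simp add: R_simps)

lemma face_generators_subset: "{\<Prod>v\<in>S. pvar v | S. S \<subseteq> V \<and> S \<notin> K} \<subseteq> polys V"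
proof -
  have "(\<Prod>v\<in>S. pvar v) \<in> polys V" if "S \<subseteq> V" for S
    using that keys_sum_single[OF finite_subset[OF that finite_V]]
    unfolding prod_pvar[OF finite_subset[OF that finite_V]] by (intro mon_in_polys) simp
  then show ?thesis
    by auto
qed

lemma generators_subset: "generators V K \<Theta> \<subseteq> polys V"
  using face_generators_subset params homogeneous_polys_subset[of V 1] by (auto simp: generators_def)

lemma relations_subset: "J \<subseteq> polys V"
  unfolding relations_def
  by (rule span_minimal) (use generators_subset in \<open>auto intro!: polys_mult mon_in_polys subspace_polys\<close>)

lemma ideal_relations: "ideal J R"
proof (rule idealI)
  show "subgroup J (add_monoid R)"
  proof
    show "J \<subseteq> carrier (add_monoid R)"
      using relations_subset by (simp add: R_simps)
    show "x \<otimes>\<^bsub>add_monoid R\<^esub> y \<in> J" if "x \<in> J" "y \<in> J" for x y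
      using that subspace_add[OF subspace_relations] by (simp add: R_simps)
    show "\<one>\<^bsub>add_monoid R\<^esub> \<in> J"
      using subspace_0[OF subspace_relations] by (simp add: R_simps)
    show "inv\<^bsub>add_monoid R\<^esub> x \<in> J" if "x \<in> J" for x
      using that subspace_neg[OF subspace_relations that] relations_subset R_uminus[of x]
      by (auto simp: a_inv_def)
  qed
qed (auto simp: R_simps R.ring_axioms intro: relations_mult relations_mult2)

abbreviation "I \<equiv> face_ideal V K"
abbreviation "FR \<equiv> face_ring V K"
abbreviation "P \<equiv> param_ideal V K \<Theta>"

lemma ideal_I: "ideal I R"
  unfolding face_ideal_def by (rule R.genideal_ideal) (use face_generators_subset in \<open>simp add: R_simps\<close>)

lemma I_subset: "I \<subseteq> J"
  unfolding face_ideal_def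
  by (rule R.genideal_minimal[OF ideal_relations]) (auto intro!: generators_relations simp: generators_def)

sublocale FR: cring FR
  unfolding face_ring_def by (rule ideal.quotient_is_cring[OF ideal_I R.cring_axioms])

lemma face_class_hom: "face_class V K \<in> ring_hom R FR"
  using ideal.rcos_ring_hom[OF ideal_I] by (simp add: face_ring_def face_class_def[abs_def])

lemma face_class_carrier: "p \<in> polys V \<Longrightarrow> face_class V K p \<in> carrier FR"
  using ring_hom_closed[OF face_class_hom] by (simp add: R_simps)

lemma params_polys: "\<theta> \<in> set \<Theta> \<Longrightarrow> \<theta> \<in> polys V"
  using params homogeneous_polys_subset[of V 1] by auto

lemma ideal_P: "ideal P FR"
  unfolding param_ideal_def
  by (rule FR.genideal_ideal) (auto intro: face_class_carrier params_polys)

text \<open>The image of \<open>J\<close> in the face ring is an ideal, because the quotient map is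
  surjective, and it contains the classes of the parameters.\<close>

lemma P_subset: "P \<subseteq> face_class V K ` J"
  unfolding param_ideal_def
proof (rule FR.genideal_minimal)
  show "ideal (face_class V K ` J) FR"
    using R.ring_ideal_imp_quot_ideal[OF ideal_I ideal_relations]
    by (simp add: face_ring_def face_class_def[abs_def])
qed (auto intro!: imageI generators_relations simp: generators_def)

sublocale H: cring H
  unfolding reduced_face_ring_def by (rule ideal.quotient_is_cring[OF ideal_P FR.cring_axioms])

lemma \<pi>_comp: "\<pi> = (+>\<^bsub>FR\<^esub>) P \<circ> face_class V K"
  by (simp add: reduced_class_def[abs_def] comp_def)

lemma \<pi>_hom: "\<pi> \<in> ring_hom R H"
  unfolding \<pi>_comp
  by (rule ring_hom_trans[OF face_class_hom])
    (use ideal.rcos_ring_hom[OF ideal_P] in \<open>simp add: reduced_face_ring_def\<close>)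

sublocale \<pi>: ring_hom_cring R H \<pi>
  by (intro ring_hom_cring.intro ring_hom_cring_axioms.intro R.cring_axioms H.cring_axioms \<pi>_hom)

lemma \<pi>_closed: "p \<in> polys V \<Longrightarrow> \<pi> p \<in> carrier H"
  using \<pi>.hom_closed by (simp add: R_simps)

lemma \<pi>_add: "p \<in> polys V \<Longrightarrow> q \<in> polys V \<Longrightarrow> \<pi> (p + q) = \<pi> p \<oplus>\<^bsub>H\<^esub> \<pi> q"
  using \<pi>.hom_add by (simp add: R_simps)

lemma \<pi>_mult: "p \<in> polys V \<Longrightarrow> q \<in> polys V \<Longrightarrow> \<pi> (p * q) = \<pi> p \<otimes>\<^bsub>H\<^esub> \<pi> q"
  using \<pi>.hom_mult by (simp add: R_simps)

lemma \<pi>_0: "\<pi> 0 = \<zero>\<^bsub>H\<^esub>"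
  using \<pi>.hom_zero by (simp add: R_simps)

lemma \<pi>_1: "\<pi> 1 = \<one>\<^bsub>H\<^esub>"
  using \<pi>.hom_one by (simp add: R_simps)

lemma \<pi>_power: "p \<in> polys V \<Longrightarrow> \<pi> (p ^ n) = \<pi> p [^]\<^bsub>H\<^esub> n"
proof (induction n)
  case (Suc n)
  have "p ^ n \<in> polys V"
    using Suc.prems mon_in_polys[of 0 V] by (induction n) (auto intro: polys_mult)
  then show ?case
    using Suc \<pi>_mult[of "p ^ n" p] by (simp add: mult.commute)
qed (simp add: \<pi>_1)

lemma \<pi>_surj: "\<pi> ` polys V = carrier H"
proof
  show "\<pi> ` polys V \<subseteq> carrier H"
    using \<pi>_closed by auto
  show "carrier H \<subseteq> \<pi> ` polys V"
    by (auto simp: reduced_face_ring_def FactRing_def A_RCOSETS_def' face_ring_def reduced_class_def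
      face_class_def R_simps)
qed

lemma \<pi>_generator: "g \<in> generators V K \<Theta> \<Longrightarrow> \<pi> g = \<zero>\<^bsub>H\<^esub>"
proof -
  assume g: "g \<in> generators V K \<Theta>"
  have "face_class V K g \<in> P"
  proof (cases "g \<in> set \<Theta>")
    case True
    then show ?thesis
      unfolding param_ideal_def
      by (intro subsetD[OF FR.genideal_self]) (auto intro: face_class_carrier params_polys)
  next
    case False
    then have "g \<in> I"
      unfolding face_ideal_def
      by (intro subsetD[OF R.genideal_self]) (use face_generators_subset g in \<open>auto simp: R_simps generators_def\<close>)
    then have "face_class V K g = \<zero>\<^bsub>FR\<^esub>"
      unfolding face_class_def face_ring_def FactRing_def using ideal_I R.a_rcos_zero by simp
    then show ?thesis
      using additive_subgroup.zero_closed[OF ideal.axioms(1)[OF ideal_P]] by simp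
  qed
  then show "\<pi> g = \<zero>\<^bsub>H\<^esub>"
    unfolding reduced_class_def reduced_face_ring_def FactRing_def using ideal_P FR.a_rcos_zero by simp
qed

text \<open>The homomorphism \<open>\<pi>\<close> kills the generators, hence their span.
  Conversely, if \<open>\<pi> p\<close> is zero, then \<open>P_subset\<close> gives an element of
  \<open>J\<close> with the same class as \<open>p\<close> in the face ring, and the difference lies
  in the face ideal, which is contained in \<open>J\<close>.\<close>

lemma \<pi>_zero_iff:
  assumes "p \<in> polys V"
  shows "\<pi> p = \<zero>\<^bsub>H\<^esub> \<longleftrightarrow> p \<in> J"
proof
  assume "p \<in> J"
  then have "p \<in> polys V \<and> \<pi> p = \<zero>\<^bsub>H\<^esub>"
    unfolding relations_def
  proof (induction rule: span_induct_alt)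
    case base
    show ?case
      by (simp add: \<pi>_0 subspace_0 subspace_polys)
  next
    case (step c x y)
    then obtain m g where x: "x = mon m * g" "Poly_Mapping.keys m \<subseteq> V" "g \<in> generators V K \<Theta>"
      by auto
    have "pconst c * mon m \<in> polys V" and g: "g \<in> polys V"
      using x generators_subset by (auto intro!: polys_mult mon_in_polys pconst_in_polys)
    then have "\<pi> ((pconst c * mon m) * g) = \<zero>\<^bsub>H\<^esub>" "(pconst c * mon m) * g \<in> polys V"
      using x(3) \<pi>_mult \<pi>_closed by (auto simp: \<pi>_generator intro: polys_mult)
    moreover have "c *\<^sub>R x = (pconst c * mon m) * g"
      by (simp add: x scaleR_eq_pconst mult.assoc)
    ultimately show ?case
      using step \<pi>_add by (simp add: subspace_add[OF subspace_polys])
  qed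
  then show "\<pi> p = \<zero>\<^bsub>H\<^esub>"
    by simp
next
  assume "\<pi> p = \<zero>\<^bsub>H\<^esub>"
  then have "P +>\<^bsub>FR\<^esub> face_class V K p = P"
    by (simp add: reduced_class_def reduced_face_ring_def FactRing_def)
  then have "face_class V K p \<in> P"
    using ideal.rcos_const_imp_mem[OF ideal_P] face_class_carrier[OF assms] by simp
  then obtain q where q: "q \<in> J" "face_class V K p = face_class V K q"
    using P_subset by auto
  then have qp: "q \<in> polys V"
    using relations_subset by auto
  have "p \<ominus>\<^bsub>R\<^esub> q \<in> I"
    using R.quotient_eq_iff_same_a_r_cos[OF ideal_I, of p q] assms qp q(2)
    by (simp add: R_simps face_class_def)
  then have "p - q \<in> J"
    using I_subset qp by (auto simp: a_minus_def R_uminus R_simps)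
  then show "p \<in> J"
    using subspace_add[OF subspace_relations, of "p - q" V K \<Theta> q] q(1) by simp
qed

lemma \<pi>_eq_iff:
  assumes "p \<in> polys V" and "q \<in> polys V"
  shows "\<pi> p = \<pi> q \<longleftrightarrow> p - q \<in> J"
proof -
  have pq: "p - q \<in> polys V"
    using assms subspace_diff[OF subspace_polys] by blast
  have "\<pi> p = \<pi> (p - q) \<oplus>\<^bsub>H\<^esub> \<pi> q"
    using \<pi>_add[OF pq assms(2)] by simp
  then show ?thesis
    unfolding \<pi>_zero_iff[OF pq, symmetric]
    using \<pi>_closed assms pq by (metis H.add.right_cancel H.l_zero H.zero_closed)
qed

text \<open>The bridge to \<open>graded_quotient\<close>: the right-hand side is its predicate
  \<open>lefschetz\<close> for multiplication by \<open>\<omega>\<close> on homogeneous polynomials,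
  and no quotient ring occurs in it.\<close>

lemma HL_element_iff:
  assumes \<omega>: "\<omega> \<in> homogeneous_polys V 1" and d: "complex_dim K = int d - 1"
  shows "HL_element V K \<Theta> (\<pi> \<omega>) \<longleftrightarrow> (\<forall>i. 2 * i \<le> d \<longrightarrow>
     (\<forall>x\<in>homogeneous_polys V i. ((*) \<omega> ^^ (d - 2 * i)) x \<in> J \<longrightarrow> x \<in> J) \<and>
     (\<forall>y\<in>homogeneous_polys V (d - i). \<exists>x\<in>homogeneous_polys V i. ((*) \<omega> ^^ (d - 2 * i)) x - y \<in> J))"
proof -
  have pow: "((*) \<omega> ^^ n) x = \<omega> ^ n * x" for n x
    by (induction n) (simp_all add: mult.assoc)
  have hp: "homogeneous_polys V i \<subseteq> polys V" for i
    by (rule homogeneous_polys_subset)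
  have step: "bij_betw (\<lambda>x. (\<pi> \<omega> [^]\<^bsub>H\<^esub> (d - 2 * i)) \<otimes>\<^bsub>H\<^esub> x) (graded_piece V K \<Theta> i) (graded_piece V K \<Theta> (d - i))
    \<longleftrightarrow> (\<forall>x\<in>homogeneous_polys V i. \<omega> ^ (d - 2 * i) * x \<in> J \<longrightarrow> x \<in> J) \<and>
     (\<forall>y\<in>homogeneous_polys V (d - i). \<exists>x\<in>homogeneous_polys V i. \<omega> ^ (d - 2 * i) * x - y \<in> J)"
    (is "?B \<longleftrightarrow> ?I \<and> ?S") if "2 * i \<le> d" for i
  proof -
    let ?n = "d - 2 * i"
    let ?f = "\<lambda>x. (\<pi> \<omega> [^]\<^bsub>H\<^esub> ?n) \<otimes>\<^bsub>H\<^esub> x"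
    have wn: "\<omega> ^ ?n \<in> homogeneous_polys V ?n"
      using homogeneous_polys_power[OF \<omega>] .
    then have wx: "\<omega> ^ ?n * x \<in> homogeneous_polys V (d - i)" if "x \<in> homogeneous_polys V i" for x
      using that \<open>2 * i \<le> d\<close> by (auto intro: homogeneous_polys_mult[where V = V and W = V])
    have f: "?f (\<pi> x) = \<pi> (\<omega> ^ ?n * x)" if "x \<in> homogeneous_polys V i" for x
      using that hp wn \<pi>_mult[of "\<omega> ^ ?n" x] \<pi>_power[of \<omega> ?n] \<omega> by (simp add: subset_eq)
    have inj: "inj_on ?f (graded_piece V K \<Theta> i) \<longleftrightarrow> ?I"
    proof
      assume L: "inj_on ?f (graded_piece V K \<Theta> i)"
      show ?I
      proof (intro ballI impI)
        fix x assume x: "x \<in> homogeneous_polys V i" "\<omega> ^ ?n * x \<in> J"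
        have z: "0 \<in> homogeneous_polys V i"
          by (simp add: subspace_0 subspace_homogeneous_polys)
        have "\<pi> (\<omega> ^ ?n * x) = \<pi> (\<omega> ^ ?n * 0)"
          using x(2) relations_subset by (subst \<pi>_eq_iff) (auto simp: subspace_0 subspace_polys)
        then have "?f (\<pi> x) = ?f (\<pi> 0)"
          using f x z by simp
        then have "\<pi> x = \<pi> 0"
          using L x z by (auto simp: inj_on_def graded_piece_def)
        then show "x \<in> J"
          using \<pi>_eq_iff[of x 0] x hp by (auto simp: subspace_0 subspace_polys)
      qed
    next
      assume R: ?I
      show "inj_on ?f (graded_piece V K \<Theta> i)"
      proof (rule inj_onI)
        fix a b assume "a \<in> graded_piece V K \<Theta> i" "b \<in> graded_piece V K \<Theta> i" and ab: "?f a = ?f b"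
        then obtain x y where x: "a = \<pi> x" "x \<in> homogeneous_polys V i"
          and y: "b = \<pi> y" "y \<in> homogeneous_polys V i"
          by (auto simp: graded_piece_def)
        have "\<pi> (\<omega> ^ ?n * x) = \<pi> (\<omega> ^ ?n * y)"
          using ab f x y by simp
        then have "\<omega> ^ ?n * x - \<omega> ^ ?n * y \<in> J"
          using \<pi>_eq_iff wx[OF x(2)] wx[OF y(2)] hp by blast
        then have "\<omega> ^ ?n * (x - y) \<in> J"
          by (simp add: right_diff_distrib)
        moreover have "x - y \<in> homogeneous_polys V i"
          using x y by (simp add: subspace_diff subspace_homogeneous_polys)
        ultimately have "x - y \<in> J"
          using R by blast
        then show "a = b"
          using \<pi>_eq_iff x y hp by blast
      qed
    qed
    have surj: "?f ` graded_piece V K \<Theta> i = graded_piece V K \<Theta> (d - i) \<longleftrightarrow> ?S"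
    proof -
      have img: "?f ` graded_piece V K \<Theta> i = (\<lambda>x. \<pi> (\<omega> ^ ?n * x)) ` homogeneous_polys V i"
        using f by (auto simp: graded_piece_def image_image)
      have sub: "(\<lambda>x. \<pi> (\<omega> ^ ?n * x)) ` homogeneous_polys V i \<subseteq> graded_piece V K \<Theta> (d - i)"
        using wx by (auto simp: graded_piece_def)
      have eq: "\<pi> y = \<pi> (\<omega> ^ ?n * x) \<longleftrightarrow> \<omega> ^ ?n * x - y \<in> J"
        if "y \<in> homogeneous_polys V (d - i)" "x \<in> homogeneous_polys V i" for x y
        unfolding eq_commute[of "\<pi> y"] by (rule \<pi>_eq_iff[OF subsetD[OF hp wx[OF that(2)]] subsetD[OF hp that(1)]])
      have "graded_piece V K \<Theta> (d - i) \<subseteq> (\<lambda>x. \<pi> (\<omega> ^ ?n * x)) ` homogeneous_polys V i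
        \<longleftrightarrow> (\<forall>y\<in>homogeneous_polys V (d - i). \<exists>x\<in>homogeneous_polys V i. \<pi> y = \<pi> (\<omega> ^ ?n * x))"
        by (auto simp: graded_piece_def)
      also have "\<dots> \<longleftrightarrow> ?S"
        by (intro ball_cong bex_cong refl eq)
      finally show ?thesis
        unfolding img using sub by blast
    qed
    show ?thesis
      unfolding bij_betw_def inj surj ..
  qed
  have "\<pi> \<omega> \<in> graded_piece V K \<Theta> 1"
    using \<omega> by (auto simp: graded_piece_def)
  moreover have "nat (complex_dim K + 1) = d"
    using d by simp
  ultimately have "HL_element V K \<Theta> (\<pi> \<omega>) \<longleftrightarrow> (\<forall>i\<le>d div 2. bij_betw (\<lambda>x. (\<pi> \<omega> [^]\<^bsub>H\<^esub> (d - 2 * i)) \<otimes>\<^bsub>H\<^esub> x)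
      (graded_piece V K \<Theta> i) (graded_piece V K \<Theta> (d - i)))"
    by (simp add: HL_element_def Let_def)
  also have "\<dots> \<longleftrightarrow> (\<forall>i. 2 * i \<le> d \<longrightarrow> bij_betw (\<lambda>x. (\<pi> \<omega> [^]\<^bsub>H\<^esub> (d - 2 * i)) \<otimes>\<^bsub>H\<^esub> x)
      (graded_piece V K \<Theta> i) (graded_piece V K \<Theta> (d - i)))"
    by (simp add: less_eq_div_iff_mult_less_eq mult.commute)
  finally show ?thesis
    unfolding pow using step by simp
qed

end

section \<open>Linear forms and monomials of bounded degree\<close>

lemma mdeg_eq_0_iff: "mdeg m = 0 \<longleftrightarrow> m = 0"
  by (auto simp: mdeg_def in_keys_iff intro!: poly_mapping_eqI)

lemma mdeg_single: "mdeg (Poly_Mapping.single v k) = k"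
  by (simp add: mdeg_def)

lemma madd_remove_one:
  fixes m :: "'v \<Rightarrow>\<^sub>0 nat"
  assumes "v \<in> Poly_Mapping.keys m"
  shows "m = Poly_Mapping.single v 1 + (m - Poly_Mapping.single v 1)"
  using assms by (auto intro!: poly_mapping_eqI simp: lookup_add lookup_minus lookup_single when_def in_keys_iff)

lemma mdeg_eq_1D:
  assumes "mdeg m = 1"
  obtains v where "m = Poly_Mapping.single v 1" and "v \<in> Poly_Mapping.keys m"
proof -
  have "m \<noteq> 0"
    using assms by auto
  then obtain v where v: "v \<in> Poly_Mapping.keys m"
    by fastforce
  have "mdeg (m - Poly_Mapping.single v 1) = 0"
    using arg_cong[OF madd_remove_one[OF v], of mdeg] assms unfolding mdeg_add mdeg_single by simp
  then show ?thesis
    using that v madd_remove_one[OF v] by (simp add: mdeg_eq_0_iff)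
qed

lemma linear_forms_eq_span: "homogeneous_polys V 1 = span (pvar ` V)"
proof -
  have "mon ` {m. Poly_Mapping.keys m \<subseteq> V \<and> mdeg m = 1} = pvar ` V"
  proof
    show "mon ` {m. Poly_Mapping.keys m \<subseteq> V \<and> mdeg m = 1} \<subseteq> pvar ` V"
    proof clarify
      fix m :: "'a \<Rightarrow>\<^sub>0 nat" assume "Poly_Mapping.keys m \<subseteq> V" "mdeg m = 1"
      then show "mon m \<in> pvar ` V"
        by (elim mdeg_eq_1D) (auto simp: pvar_def)
    qed
    show "pvar ` V \<subseteq> mon ` {m. Poly_Mapping.keys m \<subseteq> V \<and> mdeg m = 1}"
      by (auto simp: pvar_def mdeg_single)
  qed
  then show ?thesis
    by (simp only: homogeneous_polys_eq_span)
qed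

lemma lookup_le_mdeg: "Poly_Mapping.lookup m v \<le> mdeg m"
proof (cases "v \<in> Poly_Mapping.keys m")
  case True
  then show ?thesis
    unfolding mdeg_def using member_le_sum[of v "Poly_Mapping.keys m" "Poly_Mapping.lookup m"] by simp
qed (simp add: in_keys_iff)

lemma finite_monomials:
  assumes "finite V"
  shows "finite {m :: 'v \<Rightarrow>\<^sub>0 nat. Poly_Mapping.keys m \<subseteq> V \<and> mdeg m < n}"
proof (rule finite_imageD)
  let ?M = "{m :: 'v \<Rightarrow>\<^sub>0 nat. Poly_Mapping.keys m \<subseteq> V \<and> mdeg m < n}"
  have "finite {f :: 'v \<Rightarrow> nat. \<forall>v. (v \<in> V \<longrightarrow> f v \<in> {..<n}) \<and> (v \<notin> V \<longrightarrow> f v = 0)}"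
    using assms by (rule finite_set_of_finite_funs) simp
  moreover have "Poly_Mapping.lookup ` ?M
      \<subseteq> {f. \<forall>v. (v \<in> V \<longrightarrow> f v \<in> {..<n}) \<and> (v \<notin> V \<longrightarrow> f v = 0)}"
  proof clarify
    fix m :: "'v \<Rightarrow>\<^sub>0 nat" and v
    assume m: "Poly_Mapping.keys m \<subseteq> V" "mdeg m < n"
    show "(v \<in> V \<longrightarrow> Poly_Mapping.lookup m v \<in> {..<n}) \<and> (v \<notin> V \<longrightarrow> Poly_Mapping.lookup m v = 0)"
      using m lookup_le_mdeg[of m v] by (auto simp: subset_iff in_keys_iff)
  qed
  ultimately show "finite (Poly_Mapping.lookup ` ?M)"
    by (rule rev_finite_subset)
qed (auto intro!: inj_onI poly_mapping_eqI)

section \<open>Evaluation at a point\<close>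

definition evalm :: "('v \<Rightarrow> real) \<Rightarrow> ('v \<Rightarrow>\<^sub>0 nat) \<Rightarrow> real" where
  "evalm a m = (\<Prod>v\<in>Poly_Mapping.keys m. a v ^ Poly_Mapping.lookup m v)"

abbreviation evalp :: "('v \<Rightarrow> real) \<Rightarrow> 'v mpoly \<Rightarrow> real" where
  "evalp a \<equiv> linext (evalm a)"

lemma evalm_superset:
  "finite S \<Longrightarrow> Poly_Mapping.keys m \<subseteq> S \<Longrightarrow> evalm a m = (\<Prod>v\<in>S. a v ^ Poly_Mapping.lookup m v)"
  unfolding evalm_def by (rule prod.mono_neutral_left) (auto simp: in_keys_iff)

lemma evalm_add: "evalm a (m + n) = evalm a m * evalm a n"
  using evalm_superset[of "Poly_Mapping.keys (m + n)" m a] evalm_superset[of "Poly_Mapping.keys (m + n)" n a]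
  by (simp add: evalm_def[of a "m + n"] lookup_add power_add prod.distrib keys_madd)

lemma evalp_mon_mult: "evalp a (mon m * q) = evalm a m * evalp a q"
proof -
  have "q \<in> span (mon ` UNIV)"
    by (simp add: in_span_mon_iff)
  then show ?thesis
  proof (induction rule: span_induct_alt)
    case base
    show ?case
      by (simp add: linear_0[OF linear_linext])
  next
    case (step c x y)
    then show ?case
      by (auto simp: distrib_left scaleR_mult_right linear_add[OF linear_linext]
          linear_scale[OF linear_linext] mon_mult evalm_add)
  qed
qed

lemma evalp_pvar: "evalp a (pvar v) = a v"
  by (simp add: pvar_def evalm_def)

lemma evalp_pvar_power: "evalp a (pvar v ^ n) = a v ^ n"
proof (induction n)
  case 0
  show ?case
    using linext_mon[of "evalm a" 0] by (simp add: evalm_def[of a 0] del: linext_mon)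
next
  case (Suc n)
  then show ?case
    using evalp_mon_mult[of a "Poly_Mapping.single v 1" "pvar v ^ n"] evalp_pvar[of a v]
    by (simp add: pvar_def)
qed

text \<open>A linear functional on linear forms is evaluation at the point whose coordinates are its
  values on the variables. The factor \<open>t\<close> moves this point along a line through the
  origin.\<close>

lemma evalp_linear_form:
  assumes "linear \<phi>" and "\<theta> \<in> homogeneous_polys V 1"
  shows "evalp (\<lambda>v. t * \<phi> (pvar v)) \<theta> = t * \<phi> \<theta>"
proof -
  have "linear (\<lambda>x. t * \<phi> x)"
    using linear_compose_scale_right[OF assms(1), of t] by simp
  then show ?thesis
    by (rule linear_eq_on[OF linear_linext _ assms(2)[unfolded linear_forms_eq_span]])
      (auto simp: evalp_pvar)
qed

locale face_presentation = presentation V K \<Theta>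
  for V :: "'v set" and K and \<Theta> +
  assumes complex: "simplicial_complex V K"
begin

text \<open>The zero locus of the face ideal is the union of the coordinate subspaces of the faces,
  so a point supported on a face and annihilated by the parameters is a common zero of all
  relations.\<close>

lemma evalp_relations:
  assumes "p \<in> J" and "\<And>\<theta>. \<theta> \<in> set \<Theta> \<Longrightarrow> evalp a \<theta> = 0" and "{v. a v \<noteq> 0} \<in> K"
  shows "evalp a p = 0"
proof -
  have gen: "evalp a g = 0" if g: "g \<in> generators V K \<Theta>" for g
  proof (cases "g \<in> set \<Theta>")
    case False
    then obtain S where S: "g = (\<Prod>v\<in>S. pvar v)" "S \<subseteq> V" "S \<notin> K"
      using g by (auto simp: generators_def)
    then have fin: "finite S"
      using finite_V finite_subset by blast
    obtain w where w: "w \<in> S" "a w = 0"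
    proof -
      have "\<not> S \<subseteq> {v. a v \<noteq> 0}"
        using S(3) assms(3) complex unfolding simplicial_complex_def by metis
      then show ?thesis
        using that by auto
    qed
    then have "evalp a (pvar w * (\<Prod>v\<in>S - {w}. pvar v)) = 0"
      using evalp_mon_mult[of a "Poly_Mapping.single w 1"] by (simp add: pvar_def evalm_def)
    then show ?thesis
      using S(1) prod.remove[OF fin w(1), of pvar] by simp
  qed (rule assms(2))
  show ?thesis
    using assms(1) unfolding relations_def
  proof (induction rule: span_induct_alt)
    case base
    show ?case
      by (simp add: linear_0[OF linear_linext])
  next
    case (step c x y)
    then show ?case
      by (auto simp: linear_add[OF linear_linext] linear_scale[OF linear_linext] evalp_mon_mult gen)
  qed
qed

lemma evalp_zero_linear_form: "\<theta> \<in> set \<Theta> \<Longrightarrow> evalp (\<lambda>_. 0) \<theta> = 0"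
  using evalp_linear_form[of "\<lambda>_. 0" \<theta> V 0] params linearI[of "\<lambda>_ :: 'v mpoly. 0 :: real"] by auto

text \<open>The origin is a common zero of the relations: its support is the empty face, and linear
  forms vanish there.\<close>

lemma one_notin_relations: "1 \<notin> J"
proof
  assume "1 \<in> J"
  then have "evalp (\<lambda>_. 0) (1 :: 'v mpoly) = 0"
    by (rule evalp_relations) (use evalp_zero_linear_form complex in \<open>auto simp: simplicial_complex_def\<close>)
  then show False
    using evalp_pvar_power[of "\<lambda>_ :: 'v. 0" undefined 0] by simp
qed

definition scalars where "scalars = range (\<lambda>r. \<pi> (pconst r))"

text \<open>The dimension theory of embedded algebras takes its scalars from a subfield of the ring,
  so the classes of constants have to form one. This requires that 1 is not 0 in
  \<open>H\<close>.\<close>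

lemma subfield_scalars: "subfield scalars H"
proof (rule H.subfieldI)
  have neq: "\<one>\<^bsub>H\<^esub> \<noteq> \<zero>\<^bsub>H\<^esub>"
    using \<pi>_zero_iff[of 1] one_notin_relations \<pi>_1 mon_in_polys[of 0 V] by simp
  have add: "\<pi> (pconst r) \<oplus>\<^bsub>H\<^esub> \<pi> (pconst s) = \<pi> (pconst (r + s))" for r s
    using \<pi>_add[OF pconst_in_polys pconst_in_polys, of r s] by (simp add: pconst_def single_add)
  have mult: "\<pi> (pconst r) \<otimes>\<^bsub>H\<^esub> \<pi> (pconst s) = \<pi> (pconst (r * s))" for r s
    using \<pi>_mult[OF pconst_in_polys pconst_in_polys, of r s] by (simp add: pconst_def mult_single)
  have one: "\<pi> (pconst 1) = \<one>\<^bsub>H\<^esub>"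
    using \<pi>_1 by (simp add: pconst_def)
  have zero: "\<pi> (pconst 0) = \<zero>\<^bsub>H\<^esub>"
    using \<pi>_0 by (simp add: pconst_def)
  have carr: "\<pi> (pconst r) \<in> carrier H" for r
    by (rule \<pi>_closed[OF pconst_in_polys])
  show "subcring scalars H"
  proof (intro H.subcringI' H.subringI)
    show "\<ominus>\<^bsub>H\<^esub> h \<in> scalars" if h: "h \<in> scalars" for h
    proof -
      obtain r where r: "h = \<pi> (pconst r)"
        using h by (auto simp: scalars_def)
      have "\<pi> (pconst (- r)) \<oplus>\<^bsub>H\<^esub> h = \<zero>\<^bsub>H\<^esub>"
        by (simp add: r add zero)
      then have "\<ominus>\<^bsub>H\<^esub> h = \<pi> (pconst (- r))"
        using H.minus_equality carr r by metis
      then show ?thesis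
        by (simp add: scalars_def)
    qed
  next
    show "\<one>\<^bsub>H\<^esub> \<in> scalars"
      unfolding scalars_def one[symmetric] by (rule rangeI)
  qed (auto simp: scalars_def add mult carr)
  show "Units (H\<lparr>carrier := scalars\<rparr>) = scalars - {\<zero>\<^bsub>H\<^esub>}"
  proof
    show "Units (H\<lparr>carrier := scalars\<rparr>) \<subseteq> scalars - {\<zero>\<^bsub>H\<^esub>}"
      using neq carr by (auto simp: Units_def scalars_def)
    show "scalars - {\<zero>\<^bsub>H\<^esub>} \<subseteq> Units (H\<lparr>carrier := scalars\<rparr>)"
    proof
      fix x assume "x \<in> scalars - {\<zero>\<^bsub>H\<^esub>}"
      then obtain r where r: "x = \<pi> (pconst r)" "r \<noteq> 0"
        using zero by (auto simp: scalars_def)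
      then have "\<pi> (pconst (inverse r)) \<otimes>\<^bsub>H\<^esub> x = \<one>\<^bsub>H\<^esub>" "x \<otimes>\<^bsub>H\<^esub> \<pi> (pconst (inverse r)) = \<one>\<^bsub>H\<^esub>"
        by (simp_all add: mult one)
      then show "x \<in> Units (H\<lparr>carrier := scalars\<rparr>)"
        using r by (auto simp: Units_def scalars_def)
    qed
  qed
qed

lemma combine_\<pi>:
  assumes "set ps \<subseteq> polys V"
  shows "H.combine (map (\<lambda>r. \<pi> (pconst r)) cs) (map \<pi> ps) = \<pi> (\<Sum>(c, p)\<leftarrow>zip cs ps. c *\<^sub>R p)
    \<and> (\<Sum>(c, p)\<leftarrow>zip cs ps. c *\<^sub>R p) \<in> polys V"
  using assms
proof (induction cs ps rule: list_induct2')
  case (4 c cs p ps)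
  then show ?case
    by (auto simp: scaleR_eq_pconst \<pi>_add \<pi>_mult pconst_in_polys polys_mult
        intro!: subspace_add[OF subspace_polys])
qed (simp_all add: \<pi>_0 subspace_0[OF subspace_polys])

section \<open>Vanishing above the dimension of the complex\<close>

lemma algebraic_variable:
  assumes fin: "H.finite_dimension scalars (carrier H)" and v: "v \<in> V"
  obtains c n where "(\<Sum>i\<le>n. c i *\<^sub>R pvar v ^ i) \<in> J" and "\<exists>i\<le>n. c i \<noteq> 0"
proof -
  obtain n where n: "H.dimension n scalars (carrier H)"
    using fin by (auto simp: H.finite_dimension_def)
  \<comment> \<open>The powers with exponents 0 to n are n + 1 elements of a space of dimension n,
    hence dependent.\<close>
  define ps where "ps = map (\<lambda>i. pvar v ^ i) [0..<Suc n]"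
  have "pvar v \<in> homogeneous_polys V 1"
    unfolding linear_forms_eq_span using v by (auto intro: span_base)
  then have ps: "set ps \<subseteq> polys V"
    using homogeneous_polys_power homogeneous_polys_subset[of V] unfolding ps_def by fastforce
  then have carr: "set (map \<pi> ps) \<subseteq> carrier H"
    using \<pi>_closed by auto
  have "\<not> H.independent scalars (map \<pi> ps)"
    using H.independent_length_le_dimension[OF subfield_scalars n _ carr] by (auto simp: ps_def)
  then obtain Ks where Ks: "length Ks = length (map \<pi> ps)" "H.combine Ks (map \<pi> ps) = \<zero>\<^bsub>H\<^esub>"
    "set Ks \<subseteq> scalars" "set Ks \<noteq> {\<zero>\<^bsub>H\<^esub>}"
    using H.dependent_imp_non_trivial_combine[OF subfield_scalars carr] by blast
  have "\<exists>cs. Ks = map (\<lambda>r. \<pi> (pconst r)) cs"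
    using Ks(3) by (simp add: scalars_def ex_map_conv) blast
  then obtain cs where cs: "Ks = map (\<lambda>r. \<pi> (pconst r)) cs"
    by blast
  have len: "length cs = Suc n"
    using Ks(1) by (simp add: cs ps_def)
  define c where "c i = cs ! i" for i
  have "(\<Sum>(c, p)\<leftarrow>zip cs ps. c *\<^sub>R p) \<in> J"
    using Ks(2) combine_\<pi>[OF ps, of cs] \<pi>_zero_iff unfolding cs by simp
  moreover have "(\<Sum>(c, p)\<leftarrow>zip cs ps. c *\<^sub>R p) = (\<Sum>i<Suc n. c i *\<^sub>R pvar v ^ i)"
    using len by (simp add: sum_list_sum_nth ps_def c_def atLeast0LessThan del: upt_Suc)
  ultimately have "(\<Sum>i\<le>n. c i *\<^sub>R pvar v ^ i) \<in> J"
    by (simp add: lessThan_Suc_atMost)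
  moreover have "\<exists>i\<le>n. c i \<noteq> 0"
  proof (rule ccontr)
    assume "\<not> (\<exists>i\<le>n. c i \<noteq> 0)"
    then have "\<forall>x\<in>set cs. x = 0"
      using len by (auto simp: c_def in_set_conv_nth)
    then have "set Ks \<subseteq> {\<zero>\<^bsub>H\<^esub>}"
      using \<pi>_0 by (auto simp: cs pconst_def)
    moreover have "set Ks \<noteq> {}"
      using len cs by auto
    ultimately show False
      using Ks(4) by (simp add: subset_singleton_iff)
  qed
  ultimately show ?thesis
    using that by blast
qed

text \<open>Otherwise some functional is 1 on the variable and 0 on the parameters and on all
  variables outside the face. It defines a line of common zeros of the relations on which the
  variable takes every real value \<open>t\<close>, so the polynomial relation from
  \<open>algebraic_variable\<close> would have all real numbers as roots.\<close>

lemma variable_in_span: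
  assumes fin: "H.finite_dimension scalars (carrier H)" and F: "F \<in> K" "v \<in> F"
  shows "pvar v \<in> span (set \<Theta> \<union> pvar ` (V - F))"
proof (rule ccontr)
  let ?S = "set \<Theta> \<union> pvar ` (V - F)"
  assume notin: "pvar v \<notin> span ?S"
  obtain B where B: "B \<subseteq> ?S" "independent B" "?S \<subseteq> span B"
    by (rule maximal_independent_subset)
  have spB: "span B = span ?S"
    unfolding span_eq using B(1,3) span_superset[of ?S] by (simp add: subset_trans[OF B(1)])
  then have "independent (insert (pvar v) B)"
    using notin B(2) by (simp add: independent_insertI)
  from linear_independent_extend[OF this, of "\<lambda>x. if x = pvar v then 1 else 0 :: real"]
  obtain \<phi> :: "'v mpoly \<Rightarrow> real" where lin: "linear \<phi>"
    and \<phi>: "\<forall>x\<in>insert (pvar v) B. \<phi> x = (if x = pvar v then 1 else 0)"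
    by auto
  have "pvar v \<notin> B"
    using notin spB span_base by blast
  then have "\<phi> b = 0" if "b \<in> B" for b
    using that \<phi> by auto
  then have "\<phi> x = 0" if "x \<in> span B" for x
    using linear_eq_0_on_span[OF lin _ that] by blast
  then have \<phi>0: "\<phi> x = 0" if "x \<in> ?S" for x
    using span_base[OF that] spB that \<open>\<And>x. x \<in> span B \<Longrightarrow> \<phi> x = 0\<close> by simp
  have \<phi>1: "\<phi> (pvar v) = 1"
    using \<phi> by simp
  have v: "v \<in> V"
    using F complex by (auto simp: simplicial_complex_def)
  obtain c n where c: "(\<Sum>i\<le>n. c i *\<^sub>R pvar v ^ i) \<in> J" "\<exists>i\<le>n. c i \<noteq> 0"
    by (rule algebraic_variable[OF fin v])
  have "(\<Sum>i\<le>n. c i * t ^ i) = 0" for t :: real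
  proof -
    \<comment> \<open>The functional is not controlled on variables outside \<open>V\<close>;
      setting these coordinates to 0 keeps the support inside \<open>F\<close> and does not change
      the values of the parameters.\<close>
    define a where "a w = t * (if w \<in> V then \<phi> (pvar w) else 0)" for w
    have "evalp a \<theta> = 0" if "\<theta> \<in> set \<Theta>" for \<theta>
    proof -
      have \<theta>: "\<theta> \<in> span (pvar ` V)"
        using that params unfolding linear_forms_eq_span by auto
      have "evalp a \<theta> = evalp (\<lambda>w. t * \<phi> (pvar w)) \<theta>"
        by (rule linear_eq_on[OF linear_linext linear_linext \<theta>]) (auto simp: evalp_pvar a_def)
      also have "\<dots> = t * \<phi> \<theta>"
        by (rule evalp_linear_form[OF lin]) (use that params in auto)
      finally show ?thesis
        using \<phi>0 that by simp
    qed
    moreover have "{w. a w \<noteq> 0} \<subseteq> F"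
      using \<phi>0 by (auto simp: a_def)
    then have "{w. a w \<noteq> 0} \<in> K"
      using F(1) complex unfolding simplicial_complex_def by metis
    ultimately have "evalp a (\<Sum>i\<le>n. c i *\<^sub>R pvar v ^ i) = 0"
      using evalp_relations[OF c(1)] by blast
    then show ?thesis
      using v \<phi>1 by (simp add: linear_sum[OF linear_linext] linear_scale[OF linear_linext]
          evalp_pvar_power a_def)
  qed
  then show False
    using polyfun_eq_0[of c n] c(2) by blast
qed

lemma nonface_monomial:
  assumes "Poly_Mapping.keys m \<subseteq> V" and "Poly_Mapping.keys m \<notin> K"
  shows "mon m \<in> J"
proof -
  let ?S = "Poly_Mapping.keys m"
  \<comment> \<open>The squarefree part of \<open>m\<close>, which is the exponent of a nonface
    generator.\<close>
  let ?s = "\<Sum>v\<in>?S. Poly_Mapping.single v (1 :: nat)"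
  have "Poly_Mapping.lookup ?s v = (if v \<in> ?S then 1 else 0)" for v
    by (simp add: lookup_sum lookup_single when_def)
  then have "m = (m - ?s) + ?s"
    by (intro poly_mapping_eqI) (auto simp: lookup_add lookup_minus in_keys_iff)
  then have "mon m = mon (m - ?s) * (\<Prod>v\<in>?S. pvar v)"
    by (simp add: prod_pvar mon_mult)
  moreover have "Poly_Mapping.keys (m - ?s) \<subseteq> V"
    using assms(1) by (auto simp: in_keys_iff lookup_minus)
  moreover have "(\<Prod>v\<in>?S. pvar v) \<in> generators V K \<Theta>"
    using assms by (auto simp: generators_def)
  ultimately show ?thesis
    by (metis relations_mult generators_relations mon_in_polys)
qed

text \<open>Modulo the linear forms, a variable of a face is a combination of variables outside the face:
  this trades a repeated variable of a monomial for a larger support.\<close>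

lemma monomial_in_relations:
  assumes fin: "H.finite_dimension scalars (carrier H)" and bound: "\<And>F. F \<in> K \<Longrightarrow> card F \<le> d"
  shows "Poly_Mapping.keys m \<subseteq> V \<Longrightarrow> d < mdeg m \<Longrightarrow> mon m \<in> J"
proof (induction "card (V - Poly_Mapping.keys m)" arbitrary: m rule: less_induct)
  case less
  let ?F = "Poly_Mapping.keys m"
  show ?case
  proof (cases "?F \<in> K")
    case False
    then show ?thesis
      using less.prems nonface_monomial by blast
  next
    case True
    \<comment> \<open>A squarefree monomial supported on a face has degree at most
      \<open>d\<close>.\<close>
    have "\<exists>v\<in>?F. 2 \<le> Poly_Mapping.lookup m v"
    proof (rule ccontr)
      assume "\<not> ?thesis"
      then have "mdeg m \<le> (\<Sum>v\<in>?F. 1)"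
        unfolding mdeg_def by (intro sum_mono) (auto simp: not_le)
      then show False
        using bound[OF True] less.prems(2) by simp
    qed
    then obtain v where v: "v \<in> ?F" "2 \<le> Poly_Mapping.lookup m v"
      by blast
    define m' where "m' = m - Poly_Mapping.single v 1"
    have m: "m = Poly_Mapping.single v 1 + m'"
      unfolding m'_def by (rule madd_remove_one[OF v(1)])
    \<comment> \<open>The exponent of \<open>v\<close> was at least 2, so one copy can be removed
      without losing \<open>v\<close> from the support. A variable outside \<open>?F\<close> then
      enlarges the support strictly, which is the induction measure.\<close>
    have m': "Poly_Mapping.keys m' = ?F"
      using v by (auto simp: m'_def in_keys_iff lookup_minus lookup_single when_def split: if_splits)
    have mp: "mon m' \<in> polys V"
      using m' less.prems(1) by (simp add: mon_in_polys)
    have "q * mon m' \<in> J" if "q \<in> span (set \<Theta> \<union> pvar ` (V - ?F))" for q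
      using that
    proof (induction rule: span_induct_alt)
      case base
      show ?case
        by (simp add: subspace_0 subspace_relations)
    next
      case (step c x y)
      have "x * mon m' \<in> J"
      proof (cases "x \<in> set \<Theta>")
        case True
        then show ?thesis
          by (intro relations_mult2 generators_relations mp) (simp add: generators_def)
      next
        case False
        then obtain w where w: "x = pvar w" "w \<in> V - ?F"
          using step by blast
        let ?n = "Poly_Mapping.single w 1 + m'"
        have "V - Poly_Mapping.keys ?n \<subset> V - ?F"
          using w(2) by (auto simp: keys_madd m')
        then have "card (V - Poly_Mapping.keys ?n) < card (V - ?F)"
          using finite_V by (intro psubset_card_mono) auto
        moreover have "mdeg ?n = mdeg m"
          using arg_cong[OF m, of mdeg] by (simp add: mdeg_add mdeg_single)
        ultimately have "mon ?n \<in> J"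
          using less w m' by (auto simp: keys_madd)
        then show ?thesis
          by (simp add: w pvar_def mon_mult)
      qed
      then show ?case
        using step
        by (simp add: distrib_right scaleR_mult_left subspace_add[OF subspace_relations]
            subspace_scale[OF subspace_relations])
    qed
    from this[OF variable_in_span[OF fin True v(1)]] have "mon (Poly_Mapping.single v 1 + m') \<in> J"
      by (simp add: pvar_def mon_mult)
    then show ?thesis
      using m by simp
  qed
qed

lemma homogeneous_polys_in_relations:
  assumes "H.finite_dimension scalars (carrier H)" and "\<And>F. F \<in> K \<Longrightarrow> card F \<le> d" and "d < j"
  shows "homogeneous_polys V j \<subseteq> J"
  unfolding homogeneous_polys_eq_span
  by (rule span_minimal) (use assms monomial_in_relations in \<open>auto simp: subspace_relations\<close>)

text \<open>The finitely many monomials of degree below \<open>n\<close> span \<open>H\<close>,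
  since all others have class zero.\<close>

lemma finite_dimensionI:
  assumes "\<And>m. Poly_Mapping.keys m \<subseteq> V \<Longrightarrow> n \<le> mdeg m \<Longrightarrow> mon m \<in> J"
  shows "H.finite_dimension scalars (carrier H)"
proof -
  obtain ms where ms: "set ms = {m. Poly_Mapping.keys m \<subseteq> V \<and> mdeg m < n}"
    using finite_list[OF finite_monomials[OF finite_V, of n]] by blast
  define Us where "Us = map (\<lambda>m. \<pi> (mon m)) ms"
  have Us: "set Us \<subseteq> carrier H"
    using ms by (auto simp: Us_def intro!: \<pi>_closed mon_in_polys)
  have in_Span: "p \<in> polys V \<and> \<pi> p \<in> H.Span scalars Us" if "p \<in> polys V" for p
    using that unfolding polys_eq_span
  proof (induction rule: span_induct_alt)
    case base
    show ?case
      using H.Span_subgroup_props(2)[OF subfield_scalars Us] by (simp add: \<pi>_0 span_0)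
  next
    case (step c x y)
    then obtain m where m: "x = mon m" "Poly_Mapping.keys m \<subseteq> V"
      by auto
    have "\<pi> x \<in> H.Span scalars Us"
    proof (cases "mdeg m < n")
      case True
      then have "\<pi> x \<in> set Us"
        using m ms by (auto simp: Us_def)
      then show ?thesis
        using H.Span_base_incl[OF subfield_scalars Us] by blast
    next
      case False
      then have "\<pi> x = \<zero>\<^bsub>H\<^esub>"
        using m assms[of m] \<pi>_zero_iff[OF mon_in_polys, of m] by (simp add: not_less)
      then show ?thesis
        using H.Span_subgroup_props(2)[OF subfield_scalars Us] by simp
    qed
    then have "\<pi> (pconst c) \<otimes>\<^bsub>H\<^esub> \<pi> x \<in> H.Span scalars Us"
      by (intro H.Span_smult_closed[OF subfield_scalars Us]) (auto simp: scalars_def)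
    moreover have "x \<in> polys V" "y \<in> polys V" "c *\<^sub>R x \<in> polys V"
      using step m by (auto simp: polys_eq_span[symmetric] mon_in_polys subspace_scale[OF subspace_polys])
    ultimately have xy: "\<pi> (pconst c) \<otimes>\<^bsub>H\<^esub> \<pi> x \<in> H.Span scalars Us"
      "x \<in> polys V" "y \<in> polys V" "c *\<^sub>R x \<in> polys V"
      by blast+
    have "\<pi> (c *\<^sub>R x + y) = (\<pi> (pconst c) \<otimes>\<^bsub>H\<^esub> \<pi> x) \<oplus>\<^bsub>H\<^esub> \<pi> y"
      using \<pi>_add[OF xy(4,3)] \<pi>_mult[OF pconst_in_polys xy(2), of c] by (simp add: scaleR_eq_pconst)
    then have "\<pi> (c *\<^sub>R x + y) \<in> H.Span scalars Us"
      using H.Span_subgroup_props(3)[OF subfield_scalars Us xy(1) conjunct2[OF step(2)]] by (simp only:)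
    then show ?case
      using subspace_add[OF subspace_polys xy(4,3)] unfolding polys_eq_span by (rule conjI[rotated])
  qed
  have "carrier H \<subseteq> H.Span scalars Us"
    unfolding \<pi>_surj[symmetric] by (intro image_subsetI conjunct2[OF in_Span])
  then have "carrier H = H.Span scalars Us"
    using H.Span_subgroup_props(1)[OF subfield_scalars Us] by (rule equalityI)
  then show ?thesis
    using H.Span_finite_dimension[OF subfield_scalars Us] by (simp only:)
qed

lemma is_lsop_iff:
  "is_lsop V K \<Theta> \<longleftrightarrow> int (length \<Theta>) = complex_dim K + 1 \<and> H.finite_dimension scalars (carrier H)"
  using params by (simp add: is_lsop_def scalars_def)

end

section \<open>Restricting monomials to a set of variables\<close>

definition restr :: "'v set \<Rightarrow> ('v \<Rightarrow>\<^sub>0 nat) \<Rightarrow> 'v \<Rightarrow>\<^sub>0 nat" where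
  "restr S m = (\<Sum>v\<in>Poly_Mapping.keys m \<inter> S. Poly_Mapping.single v (Poly_Mapping.lookup m v))"

lemma lookup_restr: "Poly_Mapping.lookup (restr S m) v = (if v \<in> S then Poly_Mapping.lookup m v else 0)"
  by (auto simp: restr_def lookup_sum lookup_single when_def in_keys_iff)

lemma keys_restr: "Poly_Mapping.keys (restr S m) = Poly_Mapping.keys m \<inter> S"
  by (auto simp: in_keys_iff lookup_restr split: if_splits)

lemma restr_add: "restr S (m + n) = restr S m + restr S n"
  by (rule poly_mapping_eqI) (simp add: lookup_add lookup_restr)

lemma restr_id: "Poly_Mapping.keys m \<subseteq> S \<Longrightarrow> restr S m = m"
  by (rule poly_mapping_eqI) (auto simp: lookup_restr in_keys_iff)

lemma restr_disjoint: "Poly_Mapping.keys m \<inter> S = {} \<Longrightarrow> restr S m = 0"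
  by (rule poly_mapping_eqI) (auto simp: lookup_restr in_keys_iff)

lemma restr_split: "restr S m + restr (- S) m = m"
  by (rule poly_mapping_eqI) (auto simp: lookup_restr lookup_add)

lemma mdeg_restr_split: "mdeg (restr S m) + mdeg (restr (- S) m) = mdeg m"
  by (metis mdeg_add restr_split)

text \<open>\<open>extend V f\<close> is the operator \<open>f \<otimes> 1\<close> on \<open>A\<^sub>V \<otimes> A\<^bsub>-V\<^esub>\<close>, where \<open>f i\<close> acts on the part of
  \<open>A\<^sub>V\<close> of degree \<open>i\<close>.\<close>

definition extend :: "'v set \<Rightarrow> (nat \<Rightarrow> 'v mpoly \<Rightarrow> 'v mpoly) \<Rightarrow> 'v mpoly \<Rightarrow> 'v mpoly" where
  "extend V f = linext (\<lambda>m. f (mdeg (restr V m)) (mon (restr V m)) * mon (restr (- V) m))"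

lemma linear_extend_op: "linear (extend V f)"
  unfolding extend_def by (rule linear_linext)

lemma extend_mon:
  "extend V f (mon m) = f (mdeg (restr V m)) (mon (restr V m)) * mon (restr (- V) m)"
  by (simp add: extend_def)

text \<open>This is the rule for \<open>f \<otimes> 1\<close> on a pure tensor, where the degree of
  the left factor selects the member of the family. Bilinearity reduces it to monomials.\<close>

lemma extend_mult:
  assumes f: "linear (f i)" and p: "p \<in> homogeneous_polys V i" and q: "q \<in> polys (- V)"
  shows "extend V f (p * q) = f i p * q"
proof -
  have mons: "extend V f (mon m * mon n) = f i (mon m) * mon n"
    if "Poly_Mapping.keys m \<subseteq> V" "mdeg m = i" "Poly_Mapping.keys n \<subseteq> - V" for m n
  proof -
    have "restr V (m + n) = m" "restr (- V) (m + n) = n"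
      using that restr_disjoint[of n V] restr_disjoint[of m "- V"]
      by (auto simp: restr_add restr_id disjoint_eq_subset_Compl)
    then show ?thesis
      by (simp add: mon_mult extend_mon that(2))
  qed
  have 1: "extend V f (mon m * q) = f i (mon m) * q" if "Poly_Mapping.keys m \<subseteq> V" "mdeg m = i" for m
    using q unfolding polys_eq_span
  proof (induction rule: span_induct_alt)
    case base
    show ?case
      by (simp add: linear_0[OF linear_extend_op])
  next
    case (step c x y)
    then obtain n where "x = mon n" "Poly_Mapping.keys n \<subseteq> - V"
      by auto
    then show ?case
      using mons[OF that] step(2)
      by (simp add: distrib_left scaleR_mult_right linear_add[OF linear_extend_op] linear_scale[OF linear_extend_op])
  qed
  show ?thesis
    using p unfolding homogeneous_polys_eq_span
  proof (induction rule: span_induct_alt)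
    case base
    show ?case
      by (simp add: linear_0[OF linear_extend_op] linear_0[OF f])
  next
    case (step c x y)
    then obtain n where "x = mon n" "Poly_Mapping.keys n \<subseteq> V" "mdeg n = i"
      by auto
    then show ?case
      using 1 step(2)
      by (simp add: distrib_right scaleR_mult_left linear_add[OF linear_extend_op]
          linear_scale[OF linear_extend_op] linear_add[OF f] linear_scale[OF f])
  qed
qed

section \<open>Joins\<close>

lemma complex_join_commute: "complex_join K L = complex_join L K"
  by (auto simp: complex_join_def)

lemma simplicial_complex_join:
  assumes "simplicial_complex V K" and "simplicial_complex W L"
  shows "simplicial_complex (V \<union> W) (complex_join K L)"
  unfolding simplicial_complex_def
proof (intro conjI ballI allI impI)
  fix F G assume "F \<in> complex_join K L" and G: "G \<subseteq> F"
  then obtain A B where F: "F = A \<union> B" "A \<in> K" "B \<in> L"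
    by (auto simp: complex_join_def)
  have "G = (G \<inter> A) \<union> (G \<inter> B)"
    using G F by blast
  moreover have "G \<inter> A \<in> K" "G \<inter> B \<in> L"
    using F assms unfolding simplicial_complex_def by (meson Int_lower2)+
  ultimately show "G \<in> complex_join K L"
    unfolding complex_join_def by blast
next
  show "{} \<in> complex_join K L"
    unfolding complex_join_def using assms by (auto simp: simplicial_complex_def intro!: exI[of _ "{}"])
next
  show "finite (V \<union> W)"
    using assms by (simp add: simplicial_complex_def)
  have "K \<subseteq> Pow V" "L \<subseteq> Pow W"
    using assms by (simp_all add: simplicial_complex_def)
  then show "complex_join K L \<subseteq> Pow (V \<union> W)"
    unfolding complex_join_def by blast
qed

lemma nonface_join:
  assumes "simplicial_complex W L" and "V \<inter> W = {}" and "S \<subseteq> V" and "S \<notin> K"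
  shows "S \<notin> complex_join K L"
proof
  assume "S \<in> complex_join K L"
  then obtain F G where FG: "S = F \<union> G" "F \<in> K" "G \<in> L"
    by (auto simp: complex_join_def)
  then have "G \<subseteq> V \<inter> W"
    using assms(1,3) by (auto simp: simplicial_complex_def)
  then show False
    using FG assms(2,4) by simp
qed

lemma card_le_complex_dim:
  assumes "simplicial_complex V K" and "complex_dim K = int d - 1"
  shows "(\<forall>F\<in>K. card F \<le> d) \<and> (\<exists>F\<in>K. card F = d)"
proof -
  have fin: "finite (card ` K)" and ne: "card ` K \<noteq> {}"
    using assms(1) finite_subset[of K "Pow V"] by (auto simp: simplicial_complex_def)
  have "Max (card ` K) = d"
    using assms(2) by (simp add: complex_dim_def)
  then show ?thesis
    using Max_in[OF fin ne] Max_ge[OF fin] by auto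
qed

lemma complex_dim_join:
  assumes K: "simplicial_complex V K" and L: "simplicial_complex W L" and "V \<inter> W = {}"
    and d: "complex_dim K = int d - 1" "complex_dim L = int e - 1"
  shows "complex_dim (complex_join K L) = int d + int e - 1"
proof -
  have card_Un: "card (F \<union> G) = card F + card G" if "F \<in> K" "G \<in> L" for F G
  proof (rule card_Un_disjoint)
    have FG: "F \<subseteq> V" "G \<subseteq> W" "finite V" "finite W"
      using that K L by (auto simp: simplicial_complex_def)
    then show "finite F" "finite G"
      using finite_subset by blast+
    show "F \<inter> G = {}"
      using FG assms(3) by blast
  qed
  obtain F G where FG: "F \<in> K" "card F = d" "G \<in> L" "card G = e"
    using card_le_complex_dim[OF K d(1)] card_le_complex_dim[OF L d(2)] by blast
  have "finite (complex_join K L)"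
    using simplicial_complex_join[OF K L] finite_subset[of _ "Pow (V \<union> W)"]
    by (auto simp: simplicial_complex_def)
  then have "Max (card ` complex_join K L) = d + e"
  proof (intro Max_eqI)
    show "y \<le> d + e" if "y \<in> card ` complex_join K L" for y
      using that card_Un card_le_complex_dim[OF K d(1)] card_le_complex_dim[OF L d(2)]
      by (auto simp: complex_join_def intro!: add_mono)
    have "card (F \<union> G) \<in> card ` complex_join K L"
      using FG by (intro imageI) (auto simp: complex_join_def)
    then show "d + e \<in> card ` complex_join K L"
      using card_Un FG by simp
  qed simp
  then show ?thesis
    by (simp add: complex_dim_def)
qed

section \<open>Relations of a join\<close>

lemma relations_mono:
  assumes "V \<subseteq> V'" and "\<And>S. S \<subseteq> V \<Longrightarrow> S \<notin> K \<Longrightarrow> S \<notin> K'" and "set \<Theta> \<subseteq> set \<Theta>'"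
  shows "relations V K \<Theta> \<subseteq> relations V' K' \<Theta>'"
proof -
  have "generators V K \<Theta> \<subseteq> generators V' K' \<Theta>'"
    unfolding generators_def using assms by (intro Un_mono) (auto, metis subset_trans)
  then show ?thesis
    unfolding relations_def using assms(1) by (intro span_mono) blast
qed

lemma relations_join_commute:
  "relations (V \<union> W) (complex_join K L) (\<Theta> @ \<Xi>) = relations (W \<union> V) (complex_join L K) (\<Xi> @ \<Theta>)"
proof (rule antisym)
  show "relations (V \<union> W) (complex_join K L) (\<Theta> @ \<Xi>) \<subseteq> relations (W \<union> V) (complex_join L K) (\<Xi> @ \<Theta>)"
    by (rule relations_mono) (auto simp: complex_join_commute)
  show "relations (W \<union> V) (complex_join L K) (\<Xi> @ \<Theta>) \<subseteq> relations (V \<union> W) (complex_join K L) (\<Theta> @ \<Xi>)"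
    by (rule relations_mono) (auto simp: complex_join_commute)
qed

lemma relations_join_left:
  assumes "simplicial_complex W L" and "V \<inter> W = {}"
  shows "relations V K \<Theta> \<subseteq> relations (V \<union> W) (complex_join K L) (\<Theta> @ \<Xi>)"
  by (rule relations_mono) (use nonface_join[OF assms] in auto)

lemma relations_join_right:
  assumes "simplicial_complex V K" and "V \<inter> W = {}"
  shows "relations W L \<Xi> \<subseteq> relations (V \<union> W) (complex_join K L) (\<Theta> @ \<Xi>)"
  unfolding relations_join_commute[of V] by (rule relations_join_left) (use assms in auto)

lemma face_presentation_join:
  assumes "face_presentation V K \<Theta>" and "face_presentation W L \<Xi>"
  shows "face_presentation (V \<union> W) (complex_join K L) (\<Theta> @ \<Xi>)"
proof -
  interpret K: face_presentation V K \<Theta> by fact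
  interpret L: face_presentation W L \<Xi> by fact
  show ?thesis
  proof
    show "set (\<Theta> @ \<Xi>) \<subseteq> homogeneous_polys (V \<union> W) 1"
      using K.params L.params homogeneous_polys_mono[of V "V \<union> W" 1] homogeneous_polys_mono[of W "V \<union> W" 1]
      by auto
  qed (use K.finite_V L.finite_V simplicial_complex_join[OF K.complex L.complex] in auto)
qed

text \<open>The relations of the join are spanned by products in which one factor is a relation of
  \<open>K\<close> or of \<open>L\<close>, and \<open>f\<close> acts on the left factor only. Each
  monomial multiple of a generator is rewritten as such a product with a homogeneous left
  factor.\<close>

lemma extend_relations:
  assumes "face_presentation V K \<Theta>" and "face_presentation W L \<Xi>" and disj: "V \<inter> W = {}"
    and lin: "\<And>j. linear (f j)"
    and f_polys: "\<And>j x. x \<in> homogeneous_polys V j \<Longrightarrow> f j x \<in> polys V"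
    and f_rel: "\<And>j x. x \<in> homogeneous_polys V j \<Longrightarrow> x \<in> relations V K \<Theta> \<Longrightarrow> f j x \<in> relations V K \<Theta>"
    and p: "p \<in> relations (V \<union> W) (complex_join K L) (\<Theta> @ \<Xi>)"
  shows "extend V f p \<in> relations (V \<union> W) (complex_join K L) (\<Theta> @ \<Xi>)"
proof -
  interpret K: face_presentation V K \<Theta> by fact
  interpret L: face_presentation W L \<Xi> by fact
  let ?J = "relations (V \<union> W) (complex_join K L) (\<Theta> @ \<Xi>)"
  have left: "f i x * q \<in> ?J" if "x \<in> homogeneous_polys V i" "x \<in> relations V K \<Theta>" "q \<in> polys W" for i x q
    using f_rel[OF that(1,2)] relations_join_left[OF L.complex disj, of K \<Theta> \<Xi>] that(3) polys_mono[of W "V \<union> W"]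
    by (intro relations_mult2) auto
  have right: "f i x * q \<in> ?J" if "x \<in> homogeneous_polys V i" "q \<in> relations W L \<Xi>" for i x q
    using f_polys[OF that(1)] relations_join_right[OF K.complex disj, of L \<Xi> \<Theta>] that(2) polys_mono[of V "V \<union> W"]
    by (intro relations_mult) auto
  have W: "W \<subseteq> - V"
    using disj by auto
  have ext: "extend V f (x * q) = f i x * q" if "x \<in> homogeneous_polys V i" "q \<in> polys W" for i x q
    using extend_mult[OF lin that(1), of q] that(2) polys_mono[OF W] by auto
  have gen: "extend V f (mon m * g) \<in> ?J"
    if m: "Poly_Mapping.keys m \<subseteq> V \<union> W" and g: "g \<in> generators (V \<union> W) (complex_join K L) (\<Theta> @ \<Xi>)" for m g
  proof -
    let ?a = "restr V m" and ?b = "restr (- V) m"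
    have ab: "mon m = mon ?a * mon ?b"
      by (simp add: mon_mult restr_split)
    have a: "mon ?a \<in> homogeneous_polys V (mdeg ?a)"
      by (rule mon_in_homogeneous_polys) (auto simp: keys_restr)
    have b: "mon ?b \<in> polys W"
      by (rule mon_in_polys) (use m in \<open>auto simp: keys_restr\<close>)
    consider "g \<in> set \<Theta>" | "g \<in> set \<Xi>"
      | S where "g = (\<Prod>v\<in>S. pvar v)" "S \<subseteq> V \<union> W" "S \<notin> complex_join K L"
      using g by (auto simp: generators_def)
    then show ?thesis
    proof cases
      case 1
      \<comment> \<open>Parameters being homogeneous, the whole left factor has one degree, so a
        single member of the family \<open>f\<close> acts on it.\<close>
      have "mon ?a * g \<in> homogeneous_polys V (mdeg ?a + 1)"
        using homogeneous_polys_mult[OF a] K.params 1 by blast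
      moreover have "mon ?a * g \<in> relations V K \<Theta>"
        using 1 a homogeneous_polys_subset[of V]
        by (intro relations_mult generators_relations) (auto simp: generators_def)
      moreover have "mon m * g = (mon ?a * g) * mon ?b"
        by (simp add: ab algebra_simps)
      ultimately show ?thesis
        using left b ext by metis
    next
      case 2
      have "mon ?b * g \<in> relations W L \<Xi>"
        using 2 b by (intro relations_mult generators_relations) (auto simp: generators_def)
      moreover have "mon m * g = mon ?a * (mon ?b * g)"
        by (simp add: ab algebra_simps)
      moreover have "mon ?b * g \<in> polys W"
        using L.params_polys 2 b polys_mult by blast
      ultimately show ?thesis
        using right a ext by metis
    next
      case 3
      have fin: "finite S"
        using 3(2) K.finite_V L.finite_V finite_subset by blast
      \<comment> \<open>A nonface of the join may have vertices on both sides, so its monomial is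
        merged with \<open>m\<close> before the product is split anew.\<close>
      define n where "n = m + (\<Sum>v\<in>S. Poly_Mapping.single v 1)"
      have keys_n: "Poly_Mapping.keys n = Poly_Mapping.keys m \<union> S"
        unfolding n_def keys_madd keys_sum_single[OF fin] ..
      let ?a = "restr V n" and ?b = "restr (- V) n"
      have n: "mon m * g = mon ?a * mon ?b"
        unfolding 3(1) prod_pvar[OF fin] mon_mult restr_split n_def ..
      have a: "mon ?a \<in> homogeneous_polys V (mdeg ?a)"
        by (rule mon_in_homogeneous_polys) (auto simp: keys_restr)
      have bW: "Poly_Mapping.keys ?b \<subseteq> W"
        using m 3(2) by (auto simp: keys_restr keys_n)
      then have b: "mon ?b \<in> polys W"
        by (rule mon_in_polys)
      have "S \<inter> V \<notin> K \<or> S \<inter> W \<notin> L"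
      proof (rule ccontr)
        assume "\<not> ?thesis"
        moreover have "S = (S \<inter> V) \<union> (S \<inter> W)"
          using 3(2) by blast
        ultimately show False
          using 3(3) unfolding complex_join_def by blast
      qed
      moreover have "S \<inter> V \<subseteq> Poly_Mapping.keys ?a" "S \<inter> W \<subseteq> Poly_Mapping.keys ?b"
        using disj by (auto simp: keys_restr keys_n)
      ultimately have "Poly_Mapping.keys ?a \<notin> K \<or> Poly_Mapping.keys ?b \<notin> L"
        using K.complex L.complex unfolding simplicial_complex_def by metis
      then have "mon ?a \<in> relations V K \<Theta> \<or> mon ?b \<in> relations W L \<Xi>"
        using K.nonface_monomial[of ?a] L.nonface_monomial[OF bW] by (auto simp: keys_restr)
      then show ?thesis
        unfolding n ext[OF a b] using left[OF a _ b] right[OF a] by blast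
    qed
  qed
  show ?thesis
    using p unfolding relations_def
  proof (induction rule: span_induct_alt)
    case base
    show ?case
      by (simp add: linear_0[OF linear_extend_op] span_0)
  next
    case (step c x y)
    then have "extend V f x \<in> ?J"
      using gen by auto
    then show ?case
      using step(2) unfolding relations_def[symmetric]
      by (simp add: linear_add[OF linear_extend_op] linear_scale[OF linear_extend_op]
          subspace_add[OF subspace_relations] subspace_scale[OF subspace_relations])
  qed
qed

section \<open>Parameters and Lefschetz elements of a join\<close>

lemma lsop_join:
  assumes "face_presentation V K \<Theta>" and "face_presentation W L \<Xi>" and disj: "V \<inter> W = {}"
    and d: "complex_dim K = int d - 1" "complex_dim L = int d' - 1"
    and lsop: "is_lsop V K \<Theta>" "is_lsop W L \<Xi>"
  shows "is_lsop (V \<union> W) (complex_join K L) (\<Theta> @ \<Xi>)"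
proof -
  interpret K: face_presentation V K \<Theta> by fact
  interpret L: face_presentation W L \<Xi> by fact
  interpret J: face_presentation "V \<union> W" "complex_join K L" "\<Theta> @ \<Xi>"
    by (rule face_presentation_join) fact+
  have "mon m \<in> relations (V \<union> W) (complex_join K L) (\<Theta> @ \<Xi>)"
    if m: "Poly_Mapping.keys m \<subseteq> V \<union> W" "d + d' + 1 \<le> mdeg m" for m
  proof -
    let ?a = "restr V m" and ?b = "restr (- V) m"
    have ab: "mon m = mon ?a * mon ?b"
      by (simp add: mon_mult restr_split)
    have keys: "Poly_Mapping.keys ?a \<subseteq> V" "Poly_Mapping.keys ?b \<subseteq> W"
      using m by (auto simp: keys_restr)
    have polys: "mon ?a \<in> polys (V \<union> W)" "mon ?b \<in> polys (V \<union> W)"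
      using keys by (auto intro!: mon_in_polys)
    \<comment> \<open>Degree above \<open>d + d'\<close> forces one of the two parts above the
      dimension of its own complex, where every monomial is a relation.\<close>
    consider "d < mdeg ?a" | "d' < mdeg ?b"
      using m(2) mdeg_restr_split[of V m] by linarith
    then show ?thesis
    proof cases
      case 1
      then have "mon ?a \<in> relations V K \<Theta>"
        using K.monomial_in_relations[of d ?a] keys lsop K.is_lsop_iff card_le_complex_dim[OF K.complex d(1)] by blast
      then show ?thesis
        using relations_join_left[OF L.complex disj] polys unfolding ab by (blast intro: relations_mult2)
    next
      case 2
      then have "mon ?b \<in> relations W L \<Xi>"
        using L.monomial_in_relations[of d' ?b] keys lsop L.is_lsop_iff card_le_complex_dim[OF L.complex d(2)] by blast
      then show ?thesis
        using relations_join_right[OF K.complex disj] polys unfolding ab by (blast intro: relations_mult)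
    qed
  qed
  then have "J.H.finite_dimension J.scalars (carrier (reduced_face_ring (V \<union> W) (complex_join K L) (\<Theta> @ \<Xi>)))"
    by (rule J.finite_dimensionI)
  then show ?thesis
    using lsop complex_dim_join[OF K.complex L.complex disj d] d
    by (simp add: J.is_lsop_iff K.is_lsop_iff L.is_lsop_iff)
qed

lemma (in face_presentation) graded_quotient:
  assumes "is_lsop V K \<Theta>" and "complex_dim K = int d - 1" and \<omega>: "\<omega> \<in> homogeneous_polys V 1"
  shows "graded_quotient (homogeneous_polys V) J ((*) \<omega>) d"
proof
  show "homogeneous_polys V j \<subseteq> J" if "d < j" for j
    using homogeneous_polys_in_relations[of d j] card_le_complex_dim[OF complex assms(2)] that assms(1) is_lsop_iff
    by blast
  show "\<omega> * x \<in> homogeneous_polys V (Suc j)" if "x \<in> homogeneous_polys V j" for x j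
    using homogeneous_polys_mult[OF \<omega> that] by simp
  show "\<omega> * x \<in> J" if "x \<in> J" for x
    using relations_mult[OF _ that] \<omega> homogeneous_polys_subset[of V 1] by blast
qed (auto simp: subspace_homogeneous_polys subspace_relations linear_mult
    intro: linear_add[OF linear_mult] linear_scale[OF linear_mult])

lemma HL_element_join:
  assumes pres: "face_presentation V K \<Theta>" "face_presentation W L \<Xi>" and disj: "V \<inter> W = {}"
    and d: "complex_dim K = int d - 1" "complex_dim L = int d' - 1"
    and lsop: "is_lsop V K \<Theta>" "is_lsop W L \<Xi>"
    and \<omega>: "\<omega> \<in> homogeneous_polys V 1" "\<omega>' \<in> homogeneous_polys W 1"
    and HL: "HL_element V K \<Theta> (reduced_class V K \<Theta> \<omega>)" "HL_element W L \<Xi> (reduced_class W L \<Xi> \<omega>')"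
  shows "HL_element (V \<union> W) (complex_join K L) (\<Theta> @ \<Xi>)
    (reduced_class (V \<union> W) (complex_join K L) (\<Theta> @ \<Xi>) (\<omega> + \<omega>'))"
proof -
  interpret K: face_presentation V K \<Theta> by fact
  interpret L: face_presentation W L \<Xi> by fact
  interpret J: face_presentation "V \<union> W" "complex_join K L" "\<Theta> @ \<Xi>"
    by (rule face_presentation_join) fact+
  let ?J = "relations (V \<union> W) (complex_join K L) (\<Theta> @ \<Xi>)"
  let ?A = "homogeneous_polys (V \<union> W)"
  interpret QK: graded_quotient "homogeneous_polys V" "relations V K \<Theta>" "(*) \<omega>" d
    by (rule K.graded_quotient) fact+
  interpret QL: graded_quotient "homogeneous_polys W" "relations W L \<Xi>" "(*) \<omega>'" d'
    by (rule L.graded_quotient) fact+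
  have \<omega>\<omega>': "\<omega> + \<omega>' \<in> ?A 1"
    using \<omega> homogeneous_polys_mono[of V "V \<union> W" 1] homogeneous_polys_mono[of W "V \<union> W" 1]
    by (intro subspace_add subspace_homogeneous_polys) auto
  have dim: "complex_dim (complex_join K L) = int (d + d') - 1"
    using complex_dim_join[OF K.complex L.complex disj d] by simp
  interpret Q: graded_quotient ?A ?J "(*) (\<omega> + \<omega>')" "d + d'"
    by (rule J.graded_quotient[OF lsop_join[OF pres disj d lsop] dim \<omega>\<omega>'])
  have QK.lefschetz
    using HL(1) K.HL_element_iff[OF \<omega>(1) d(1)] by (simp add: QK.lefschetz_def)
  then obtain f where f: "QK.lowering f"
    using QK.lowering_if_lefschetz by blast
  have QL.lefschetz
    using HL(2) L.HL_element_iff[OF \<omega>(2) d(2)] by (simp add: QL.lefschetz_def)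
  then obtain g where g: "QL.lowering g"
    using QL.lowering_if_lefschetz by blast
  note f_lin = QK.linear_f[OF f] and g_lin = QL.linear_f[OF g]
  \<comment> \<open>No degree index is attached: \<open>extend\<close> reads the degrees of the two
    parts off each monomial.\<close>
  define F where "F p = extend V f p + extend W g p" for p
  have lin_F: "linear F"
    unfolding F_def by (intro linear_compose_add linear_extend_op)
  have VW: "V \<subseteq> - W" "W \<subseteq> - V"
    using disj by auto
  have F_mult: "F (p * q) = f i p * q + p * g j q" if "p \<in> homogeneous_polys V i" "q \<in> homogeneous_polys W j" for p q i j
  proof -
    have "q \<in> polys (- V)" "p \<in> polys (- W)"
      using that homogeneous_polys_subset[of V] homogeneous_polys_subset[of W] polys_mono[OF VW(1)] polys_mono[OF VW(2)]
      by blast+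
    then have "extend V f (p * q) = f i p * q" "extend W g (q * p) = g j q * p"
      using extend_mult[of f i, OF f_lin that(1)] extend_mult[of g j, OF g_lin that(2)] by simp_all
    then show ?thesis
      by (simp add: F_def mult.commute)
  qed
  have split: "\<exists>p q i j. x = p * q \<and> p \<in> homogeneous_polys V i \<and> q \<in> homogeneous_polys W j \<and> k = i + j"
    if x: "x \<in> mon ` {m. Poly_Mapping.keys m \<subseteq> V \<union> W \<and> mdeg m = k}" for x k
  proof -
    obtain m where m: "x = mon m" "Poly_Mapping.keys m \<subseteq> V \<union> W" "mdeg m = k"
      using x by auto
    have "x = mon (restr V m) * mon (restr (- V) m)"
      by (simp add: mon_mult restr_split m)
    moreover have "mon (restr V m) \<in> homogeneous_polys V (mdeg (restr V m))"
      "mon (restr (- V) m) \<in> homogeneous_polys W (mdeg (restr (- V) m))"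
      using m(2) by (auto intro!: mon_in_homogeneous_polys simp: keys_restr)
    ultimately show ?thesis
      using mdeg_restr_split[of V m] m(3) by metis
  qed
  have mult_A: "p * q \<in> ?A k" if "p \<in> homogeneous_polys V i" "q \<in> homogeneous_polys W j" "k = i + j" for p q i j k
    using homogeneous_polys_mult[OF that(1,2) _ _ that(3)] by blast
  have F_0: "F x = 0" if "x \<in> ?A 0" for x
  proof (rule linear_eq_0_on_span[OF lin_F _ that[unfolded homogeneous_polys_eq_span]])
    fix x assume "x \<in> mon ` {m. Poly_Mapping.keys m \<subseteq> V \<union> W \<and> mdeg m = 0}"
    from split[OF this] show "F x = 0"
      using F_mult QK.f_zero[OF f] QL.f_zero[OF g] by fastforce
  qed
  have F_A: "F x \<in> ?A k" if "x \<in> ?A (Suc k)" for x k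
    using that unfolding homogeneous_polys_eq_span[of _ "Suc k"]
  proof (induction rule: span_induct_alt)
    case base
    show ?case
      by (simp add: linear_0[OF lin_F] subspace_0 subspace_homogeneous_polys)
  next
    case (step c x y)
    obtain p q i j where x: "x = p * q" and p: "p \<in> homogeneous_polys V i"
      and q: "q \<in> homogeneous_polys W j" and ij: "Suc k = i + j"
      using split[OF step(1)] by blast
    have "f i p * q \<in> ?A k"
    proof (cases i)
      case 0
      then show ?thesis
        by (simp add: QK.f_zero[OF f] subspace_0 subspace_homogeneous_polys)
    next
      case (Suc i')
      then show ?thesis
        using mult_A[OF QK.f_A[OF f, of p i'] q] p ij by simp
    qed
    moreover have "p * g j q \<in> ?A k"
    proof (cases j)
      case 0
      then show ?thesis
        by (simp add: QL.f_zero[OF g] subspace_0 subspace_homogeneous_polys)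
    next
      case (Suc j')
      then show ?thesis
        using mult_A[OF p QL.f_A[OF g, of q j']] q ij by simp
    qed
    ultimately show ?case
      using step(2) F_mult[OF p q]
      by (simp add: x linear_add[OF lin_F] linear_scale[OF lin_F]
          subspace_add[OF subspace_homogeneous_polys] subspace_scale[OF subspace_homogeneous_polys])
  qed
  have f_polys: "f j x \<in> polys V" if "x \<in> homogeneous_polys V j" for j x
  proof (cases j)
    case 0
    then show ?thesis
      by (simp add: QK.f_zero[OF f] subspace_0 subspace_polys)
  next
    case (Suc i)
    then show ?thesis
      using QK.f_A[OF f, of x i] that homogeneous_polys_subset[of V i] by auto
  qed
  have g_polys: "g j x \<in> polys W" if "x \<in> homogeneous_polys W j" for j x
  proof (cases j)
    case 0
    then show ?thesis
      by (simp add: QL.f_zero[OF g] subspace_0 subspace_polys)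
  next
    case (Suc i)
    then show ?thesis
      using QL.f_A[OF g, of x i] that homogeneous_polys_subset[of W i] by auto
  qed
  have F_J: "F x \<in> ?J" if "x \<in> ?J" for x
  proof -
    have "extend V f x \<in> ?J"
      by (rule extend_relations[OF pres disj f_lin f_polys QK.f_J[OF f] that])
    \<comment> \<open>The operator on the second factor is the operator on the first factor of the
      join taken in the opposite order, which has the same relations.\<close>
    moreover have "extend W g x \<in> relations (W \<union> V) (complex_join L K) (\<Xi> @ \<Theta>)"
      by (rule extend_relations[OF pres(2,1) _ g_lin g_polys QL.f_J[OF g]])
        (use disj that[unfolded relations_join_commute[of V]] in auto)
    then have "extend W g x \<in> ?J"
      unfolding relations_join_commute[of V] .
    ultimately show ?thesis
      unfolding F_def by (rule subspace_add[OF subspace_relations])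
  qed
  have comm: "(\<omega> + \<omega>') * F x - F ((\<omega> + \<omega>') * x) - (2 * real k - real (d + d')) *\<^sub>R x \<in> ?J"
    if "x \<in> ?A k" for x k
    using that unfolding homogeneous_polys_eq_span[of _ k]
  proof (induction rule: span_induct_alt)
    case base
    show ?case
      by (simp add: linear_0[OF lin_F] subspace_0 subspace_relations)
  next
    case (step c x y)
    let ?D = "\<lambda>x. (\<omega> + \<omega>') * F x - F ((\<omega> + \<omega>') * x) - (2 * real k - real (d + d')) *\<^sub>R x"
    obtain p q i j where x: "x = p * q" and p: "p \<in> homogeneous_polys V i"
      and q: "q \<in> homogeneous_polys W j" and ij: "k = i + j"
      using split[OF step(1)] by blast
    have \<omega>p: "\<omega> * p \<in> homogeneous_polys V (Suc i)" and \<omega>q: "\<omega>' * q \<in> homogeneous_polys W (Suc j)"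
      using QK.e_A p QL.e_A q by blast+
    have pq: "p \<in> polys (V \<union> W)" "q \<in> polys (V \<union> W)"
      using p q homogeneous_polys_subset[of V] homogeneous_polys_subset[of W]
        polys_mono[of V "V \<union> W"] polys_mono[of W "V \<union> W"] by blast+
    have "F ((\<omega> + \<omega>') * (p * q)) = F ((\<omega> * p) * q) + F (p * (\<omega>' * q))"
      by (simp add: linear_add[OF lin_F, symmetric] algebra_simps)
    also have "\<dots> = f (Suc i) (\<omega> * p) * q + (\<omega> * p) * g j q + (f i p * (\<omega>' * q) + p * g (Suc j) (\<omega>' * q))"
      using F_mult[OF \<omega>p q] F_mult[OF p \<omega>q] by simp
    finally have F1: "F ((\<omega> + \<omega>') * (p * q)) = \<dots>" .
    \<comment> \<open>These are the commutator defects of the two factors. The mixed products, in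
      which one factor is raised and the other lowered, occur twice with opposite signs, so the
      defect of \<open>F\<close> is the sum of these two.\<close>
    let ?u = "\<omega> * f i p - f (Suc i) (\<omega> * p) - (2 * real i - real d) *\<^sub>R p"
    let ?w = "\<omega>' * g j q - g (Suc j) (\<omega>' * q) - (2 * real j - real d') *\<^sub>R q"
    have "?u * q \<in> ?J"
      using QK.commutator[OF f p] relations_join_left[OF L.complex disj] pq(2) by (blast intro: relations_mult2)
    moreover have "p * ?w \<in> ?J"
      using QL.commutator[OF g q] relations_join_right[OF K.complex disj] pq(1) by (blast intro: relations_mult)
    moreover have "?D x = ?u * q + p * ?w"
      unfolding x F1 F_mult[OF p q] ij
      by (simp add: algebra_simps scaleR_mult_left scaleR_mult_right)
    ultimately have "?D x \<in> ?J"
      using subspace_add[OF subspace_relations] by metis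
    moreover have "?D (c *\<^sub>R x + y) = c *\<^sub>R ?D x + ?D y"
      by (simp add: linear_add[OF lin_F] linear_scale[OF lin_F] distrib_left scaleR_mult_right
          scaleR_diff_right scaleR_add_right mult.commute)
    ultimately show ?case
      using step(2) subspace_add[OF subspace_relations] subspace_scale[OF subspace_relations] by metis
  qed
  \<comment> \<open>Member 0 of the family must vanish on the whole space, while \<open>F\<close>
    vanishes only on polynomials of degree 0; hence the case distinction.\<close>
  have "Q.lowering (\<lambda>j. if j = 0 then (\<lambda>_. 0) else F)"
    unfolding Q.lowering_def
  proof (intro conjI allI ballI)
    fix j x assume "x \<in> ?A j"
    then show "(\<omega> + \<omega>') * (if j = 0 then (\<lambda>_. 0) else F) x -
        (if Suc j = 0 then (\<lambda>_. 0) else F) ((\<omega> + \<omega>') * x) - (2 * real j - real (d + d')) *\<^sub>R x \<in> ?J"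
      using comm[of x j] F_0[of x] by (auto split: if_splits)
  qed (use lin_F F_A F_J in \<open>auto simp: subspace_0 subspace_relations intro: linearI\<close>)
  then have Q.lefschetz
    by (rule Q.lefschetz_if_lowering)
  then show ?thesis
    using J.HL_element_iff[OF \<omega>\<omega>' dim] by (simp add: Q.lefschetz_def)
qed

section \<open>Rank and nullity\<close>

context vector_space
begin

text \<open>The ambient space of chains may be infinite-dimensional, and an infinite basis has
  \<open>card\<close> 0, so monotonicity of \<open>dim\<close> is claimed only inside a finite
  span.\<close>

lemma dim_subset_finite:
  assumes "A \<subseteq> B" and "B \<subseteq> span S" and "finite S"
  shows "dim A \<le> dim B"
proof -
  obtain A' where A': "A' \<subseteq> A" "independent A'" "A \<subseteq> span A'" "card A' = dim A"
    using basis_exists[of A] by blast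
  obtain B' where B': "B' \<subseteq> B" "independent B'" "B \<subseteq> span B'" "card B' = dim B"
    using basis_exists[of B] by blast
  have "finite B'"
    using independent_span_bound[OF assms(3) B'(2)] B'(1) assms(2) by blast
  then have "card A' \<le> card B'"
    using independent_span_bound[OF _ A'(2)] A'(1) B'(3) assms(1) by blast
  then show ?thesis
    using A'(4) B'(4) by simp
qed

lemma span_disjoint_independent:
  assumes "independent (B \<union> D)" and "B \<inter> D = {}" and "x \<in> span B" and "x \<in> span D"
  shows "x = 0"
proof -
  have "representation (B \<union> D) x = representation B x" "representation (B \<union> D) x = representation D x"
    using representation_extend[OF assms(1)] assms(3,4) by blast+
  then have "representation (B \<union> D) x b = 0" for b
    using representation_ne_zero[of B x b] representation_ne_zero[of D x b] assms(2) by (metis disjoint_iff)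
  moreover have "x \<in> span (B \<union> D)"
    using assms(3) span_mono[of B "B \<union> D"] by blast
  ultimately show ?thesis
    using sum_nonzero_representation_eq[OF assms(1), of x] by simp
qed

text \<open>A basis of the kernel is extended to a basis of \<open>S\<close>. The added vectors span
  a complement of the kernel, on which the map is injective, so their images form a basis of the
  image.\<close>

lemma rank_nullity:
  assumes f: "Vector_Spaces.linear scale scale f" and S: "subspace S" "S \<subseteq> span S0" "finite S0"
  shows "dim S = dim {x \<in> S. f x = 0} + dim (f ` S)"
proof -
  interpret f: Vector_Spaces.linear scale scale f by fact
  have pair: "vector_space_pair scale scale"
    by (simp add: vector_space_pair_def vector_space_axioms)
  let ?N = "{x \<in> S. f x = 0}"
  obtain B where B: "B \<subseteq> ?N" "independent B" "?N \<subseteq> span B"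
    using maximal_independent_subset[of ?N] by blast
  have "B \<subseteq> S"
    using B(1) by blast
  from maximal_independent_subset_extend[OF this B(2)]
  obtain C where C: "B \<subseteq> C" "C \<subseteq> S" "independent C" "S \<subseteq> span C"
    by blast
  have fin: "finite C"
    using independent_span_bound[OF S(3) C(3)] C(2) S(2) by blast
  define D where "D = C - B"
  have BD: "C = B \<union> D" "B \<inter> D = {}"
    using C(1) by (auto simp: D_def)
  have ind_BD: "independent (B \<union> D)"
    using C(3) BD(1) by simp
  have ker: "x = 0" if "x \<in> span D" "f x = 0" for x
  proof -
    have "span D \<subseteq> S"
      using C(2) S(1) by (intro span_minimal) (auto simp: D_def)
    then have "x \<in> ?N"
      using that by (simp add: subset_eq)
    then have "x \<in> span B"
      using B(3) by (rule rev_subsetD)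
    then show ?thesis
      by (rule span_disjoint_independent[OF ind_BD BD(2) _ that(1)])
  qed
  have inj: "inj_on f (span D)"
  proof (rule inj_onI)
    fix x y assume "x \<in> span D" "y \<in> span D" "f x = f y"
    then have "x - y = 0"
      using ker[of "x - y"] by (simp add: span_diff f.diff)
    then show "x = y"
      by simp
  qed
  have "dim ?N = card B"
    using B by (intro dim_unique) auto
  moreover have "dim S = card C"
    using C by (intro dim_unique) auto
  moreover have "dim (f ` S) = card (f ` D)"
  proof (rule dim_unique)
    show "f ` D \<subseteq> f ` S"
      using C(2) by (auto simp: D_def)
    show "independent (f ` D)"
      by (rule vector_space_pair.linear_independent_injective_image[OF pair f _ inj])
        (rule independent_mono[OF ind_BD], simp)
    show "f ` S \<subseteq> span (f ` D)"
    proof clarify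
      fix s assume "s \<in> S"
      then obtain b x where "s = b + x" "b \<in> span B" "x \<in> span D"
        using C(4) unfolding BD(1) span_Un by blast
      moreover have "f b = 0"
        using \<open>b \<in> span B\<close> by (rule vector_space_pair.linear_eq_0_on_span[OF pair f, rotated]) (use B(1) in auto)
      ultimately show "f s \<in> span (f ` D)"
        unfolding f.span_image by (auto simp: f.add)
    qed
  qed simp
  moreover have "card (f ` D) = card D"
    by (rule card_image[OF inj_on_subset[OF inj span_superset]])
  moreover have "card C = card B + card D"
    unfolding BD(1) using fin BD by (intro card_Un_disjoint) auto
  ultimately show ?thesis
    by simp
qed

end

section \<open>The Euler characteristic\<close>

lemma boundary_add: "boundary K (c + c') = boundary K c + boundary K c'"
  by (auto simp: boundary_def algebra_simps sum.distrib)

lemma boundary_scale: "boundary K (chain_scale r c) = chain_scale r (boundary K c)"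
  by (auto simp: boundary_def chain_scale_def sum_distrib_left algebra_simps)

lemma vertex_order_cases: "u \<noteq> v \<Longrightarrow> (u, v) \<in> vertex_order \<longleftrightarrow> (v, u) \<notin> vertex_order"
  using linear_order_vertex_order
  by (auto simp: linear_order_on_def partial_order_on_def total_on_def antisym_def)

interpretation chain: vector_space chain_scale
  by (rule vector_space_chain_scale)

lemma linear_boundary: "Vector_Spaces.linear chain_scale chain_scale (boundary K)"
  by unfold_locales (simp_all add: boundary_add boundary_scale)

locale finite_complex =
  fixes V :: "'v set" and K
  assumes complex: "simplicial_complex V K"
begin

lemma finite_K: "finite K" and finite_face: "F \<in> K \<Longrightarrow> finite F" and finite_vertices: "finite (\<Union>K)"
  and face_subset: "F \<in> K \<Longrightarrow> G \<subseteq> F \<Longrightarrow> G \<in> K" and empty_face: "{} \<in> K"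
proof -
  have K: "K \<subseteq> Pow V" "finite V"
    using complex by (auto simp: simplicial_complex_def)
  then show "finite K"
    using finite_subset by auto
  show "finite F" if "F \<in> K"
    using K that finite_subset by blast
  show "finite (\<Union>K)"
    using K finite_subset[of "\<Union>K" V] by auto
qed (use complex in \<open>auto simp: simplicial_complex_def\<close>)

definition vsign :: "'v set \<Rightarrow> 'v \<Rightarrow> real" where
  "vsign G v = (- 1) ^ card {u \<in> G. (u, v) \<in> vertex_order}"

lemma vsign_insert:
  assumes "finite G" and "u \<notin> G"
  shows "vsign (insert u G) v = (if (u, v) \<in> vertex_order then - vsign G v else vsign G v)"
proof (cases "(u, v) \<in> vertex_order")
  case True
  then have "{w \<in> insert u G. (w, v) \<in> vertex_order} = insert u {w \<in> G. (w, v) \<in> vertex_order}"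
    by auto
  then show ?thesis
    using assms True by (simp add: vsign_def)
next
  case False
  then have "{w \<in> insert u G. (w, v) \<in> vertex_order} = {w \<in> G. (w, v) \<in> vertex_order}"
    by auto
  then show ?thesis
    using False by (simp add: vsign_def)
qed

text \<open>The double boundary is a sum over ordered pairs of vertices added to \<open>G\<close>.
  Exchanging the two vertices reverses the sign, as exactly one of them precedes the other.\<close>

lemma boundary_boundary:
  assumes c: "c \<in> chains K k"
  shows "boundary K (boundary K c) = 0"
proof
  fix G
  let ?U = "\<Union>K - G"
  let ?P = "{(u, v). u \<in> ?U \<and> v \<in> ?U \<and> u \<noteq> v}"
  define T where "T u v = vsign G u * (vsign (insert u G) v * c (insert v (insert u G)))" for u v
  have antisym: "T v u = - T u v" if "u \<in> ?U" "v \<in> ?U" "u \<noteq> v" for u v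
  proof (cases "finite G")
    case True
    have "insert v (insert u G) = insert u (insert v G)"
      by auto
    then show ?thesis
      using that True vertex_order_cases[OF that(3)] by (auto simp: T_def vsign_insert)
  next
    case False
    then have "insert v (insert u G) \<notin> K" "insert u (insert v G) \<notin> K"
      using finite_face by fastforce+
    then have "c (insert v (insert u G)) = 0" "c (insert u (insert v G)) = 0"
      using c by (auto simp: chains_def)
    then show ?thesis
      by (simp add: T_def)
  qed
  have "boundary K (boundary K c) G = (\<Sum>u\<in>?U. \<Sum>v\<in>\<Union>K - insert u G. T u v)"
    by (simp add: boundary_def vsign_def[symmetric] sum_distrib_left T_def)
  also have "\<dots> = (\<Sum>(u, v)\<in>?P. T u v)"
  proof -
    have "?P = Sigma ?U (\<lambda>u. \<Union>K - insert u G)"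
      by auto
    then show ?thesis
      using finite_vertices by (simp add: sum.Sigma)
  qed
  finally have X: "boundary K (boundary K c) G = (\<Sum>(u, v)\<in>?P. T u v)" .
  have "(\<Sum>(u, v)\<in>?P. T u v) = (\<Sum>(u, v)\<in>?P. T v u)"
    by (rule sum.reindex_bij_witness[of _ prod.swap prod.swap]) auto
  also have "\<dots> = (\<Sum>(u, v)\<in>?P. - T u v)"
    by (rule sum.cong[OF refl], clarify, rule antisym) auto
  also have "\<dots> = - (\<Sum>(u, v)\<in>?P. T u v)"
    by (simp add: sum_negf case_prod_unfold)
  finally show "boundary K (boundary K c) G = 0 G"
    using X by simp
qed

lemma boundary_chains:
  assumes c: "c \<in> chains K (Suc k)"
  shows "boundary K c \<in> chains K k"
  unfolding chains_def
proof (intro CollectI allI impI)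
  fix G assume "boundary K c G \<noteq> 0"
  then obtain v where v: "v \<in> \<Union>K - G" "c (insert v G) \<noteq> 0"
    unfolding boundary_def by (metis (mono_tags, lifting) mult_zero_right sum.neutral)
  then have F: "insert v G \<in> K" "card (insert v G) = Suc k"
    using c by (auto simp: chains_def)
  then have "finite G"
    using finite_face by fastforce
  then show "G \<in> K \<and> card G = k"
    using F v(1) face_subset[of "insert v G" G] by auto
qed

lemma boundary_chains_0:
  assumes "c \<in> chains K 0"
  shows "boundary K c = 0"
proof
  fix G
  \<comment> \<open>An infinite set has \<open>card\<close> 0 as well; finiteness of the faces rules
    this case out.\<close>
  have "c (insert v G) = 0" for v
    using assms finite_face[of "insert v G"] by (auto simp: chains_def)
  then show "boundary K c G = 0 G"
    by (simp add: boundary_def)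
qed

definition face_chain :: "'v set \<Rightarrow> 'v set \<Rightarrow> real" where
  "face_chain F = (\<lambda>G. if G = F then 1 else 0)"

lemma inj_face_chain: "inj face_chain"
  by (auto simp: inj_def face_chain_def fun_eq_iff split: if_splits)

lemma subspace_chains: "chain.subspace (chains K k)"
  unfolding chain.subspace_def
proof (intro conjI ballI allI)
  fix c c' assume c: "c \<in> chains K k" "c' \<in> chains K k"
  have "c F \<noteq> 0 \<or> c' F \<noteq> 0" if "(c + c') F \<noteq> 0" for F
    using that by auto
  then show "c + c' \<in> chains K k"
    using c unfolding chains_def by blast
qed (auto simp: chains_def chain_scale_def)

lemma sum_face_chain:
  assumes "finite A"
  shows "(\<Sum>F\<in>A. chain_scale (r F) (face_chain F)) G = (if G \<in> A then r G else 0)"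
proof -
  have "(\<Sum>F\<in>A. chain_scale (r F) (face_chain F)) G = (\<Sum>F\<in>A. chain_scale (r F) (face_chain F) G)"
    using assms by (induction A rule: finite_induct) auto
  then show ?thesis
    using assms by (simp add: chain_scale_def face_chain_def if_distrib cong: if_cong)
qed

lemma finite_faces: "finite {F \<in> K. card F = k}"
  using finite_K by simp

lemma chains_span: "chains K k \<subseteq> chain.span (face_chain ` {F \<in> K. card F = k})"
proof
  fix c assume c: "c \<in> chains K k"
  let ?A = "{F \<in> K. card F = k}"
  have "c = (\<Sum>F\<in>?A. chain_scale (c F) (face_chain F))"
  proof
    show "c G = (\<Sum>F\<in>?A. chain_scale (c F) (face_chain F)) G" for G
      unfolding sum_face_chain[OF finite_faces] using c by (auto simp: chains_def)
  qed
  also have "\<dots> \<in> chain.span (face_chain ` ?A)"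
    by (intro chain.span_sum chain.span_scale chain.span_base) auto
  finally show "c \<in> chain.span (face_chain ` ?A)" .
qed

lemma dim_chains: "chain.dim (chains K k) = card {F \<in> K. card F = k}"
proof -
  let ?A = "{F \<in> K. card F = k}"
  have "chain.independent (face_chain ` ?A)"
  proof (rule chain.independent_if_scalars_zero)
    fix r x assume sum: "(\<Sum>x\<in>face_chain ` ?A. chain_scale (r x) x) = 0" and "x \<in> face_chain ` ?A"
    then obtain G where G: "x = face_chain G" "G \<in> ?A"
      by auto
    have "(\<Sum>x\<in>face_chain ` ?A. chain_scale (r x) x) = (\<Sum>F\<in>?A. chain_scale (r (face_chain F)) (face_chain F))"
      by (rule sum.reindex_cong[OF inj_on_subset[OF inj_face_chain]]) auto
    then have "(\<Sum>F\<in>?A. chain_scale (r (face_chain F)) (face_chain F)) G = 0"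
      using sum by simp
    then show "r x = 0"
      unfolding sum_face_chain[OF finite_faces] using G by simp
  qed (simp add: finite_faces)
  then have "chain.dim (chains K k) = card (face_chain ` ?A)"
    using chains_span by (intro chain.dim_unique) (auto simp: chains_def face_chain_def split: if_splits)
  then show ?thesis
    using card_image[OF inj_on_subset[OF inj_face_chain]] by simp
qed

lemma dim_cycles_boundaries:
  "card {F \<in> K. card F = Suc k} = chain.dim (cycles K (Suc k)) + chain.dim (boundaries K k)"
  using chain.rank_nullity[OF linear_boundary subspace_chains chains_span, of "Suc k"] finite_faces
  by (simp add: dim_chains cycles_def boundaries_def)

lemma dim_cycles_0: "card {F \<in> K. card F = 0} = chain.dim (cycles K 0)"
proof -
  have "cycles K 0 = chains K 0"
    using boundary_chains_0 by (auto simp: cycles_def)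
  then show ?thesis
    by (simp add: dim_chains)
qed

lemma dim_boundaries_le: "chain.dim (boundaries K k) \<le> chain.dim (cycles K k)"
proof (rule chain.dim_subset_finite)
  show "boundaries K k \<subseteq> cycles K k"
    using boundary_chains boundary_boundary by (auto simp: boundaries_def cycles_def)
  show "cycles K k \<subseteq> chain.span (face_chain ` {F \<in> K. card F = k})"
    using chains_span by (auto simp: cycles_def)
qed (simp add: finite_faces)

text \<open>The sum telescopes: rank-nullity splits the faces with k + 1 elements into cycles in
  \<open>k + 1\<close> and boundaries in \<open>k\<close>, and each Betti number subtracts the
  boundaries that the next count adds. The last boundaries remain as a correction.\<close>

lemma euler_poincare_partial:
  "(\<Sum>k\<le>n. int (reduced_betti K k) * (- 1) ^ k) =
   (\<Sum>k\<le>n. int (card {F \<in> K. card F = k}) * (- 1) ^ k) - (- 1) ^ n * int (chain.dim (boundaries K n))"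
proof -
  have betti: "int (reduced_betti K k) = int (chain.dim (cycles K k)) - int (chain.dim (boundaries K k))" for k
    using dim_boundaries_le by (simp add: reduced_betti_def of_nat_diff)
  show ?thesis
  proof (induction n)
    case 0
    show ?case
      using dim_cycles_0 by (simp add: betti)
  next
    case (Suc n)
    show ?case
      unfolding sum.atMost_Suc Suc.IH betti[of "Suc n"] dim_cycles_boundaries[of n] by (simp add: algebra_simps)
  qed
qed

lemma sum_faces_by_card:
  assumes "\<And>F. F \<in> K \<Longrightarrow> card F \<le> n"
  shows "(\<Sum>F\<in>K. \<phi> (card F)) = (\<Sum>k\<le>n. int (card {F \<in> K. card F = k}) * \<phi> k)"
proof -
  have "(\<Sum>F\<in>K. \<phi> (card F)) = (\<Sum>k\<le>n. \<Sum>F\<in>{F \<in> K. card F = k}. \<phi> (card F))"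
    by (rule sum.group[symmetric]) (use assms finite_K in auto)
  also have "\<dots> = (\<Sum>k\<le>n. int (card {F \<in> K. card F = k}) * \<phi> k)"
    by (intro sum.cong refl) simp
  finally show ?thesis .
qed

lemma euler_poincare:
  assumes "\<And>F. F \<in> K \<Longrightarrow> card F \<le> n"
  shows "(\<Sum>F\<in>K. (- 1) ^ card F) = (\<Sum>k\<le>n. int (reduced_betti K k) * (- 1) ^ k)"
proof -
  have none: "{F \<in> K. card F = Suc n} = {}"
    using assms by fastforce
  \<comment> \<open>There are no faces with n + 1 elements, so rank-nullity makes the correction
    term vanish.\<close>
  have "chain.dim (boundaries K n) = 0"
    using dim_cycles_boundaries[of n] unfolding none by simp
  then show ?thesis
    using sum_faces_by_card[of n "\<lambda>k. (- 1) ^ k"] assms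
    by (simp add: euler_poincare_partial)
qed

end

section \<open>Eulerian complexes and the Dehn-Sommerville relations\<close>

definition eulerian :: "nat \<Rightarrow> 'v set set \<Rightarrow> bool" where
  "eulerian d K \<longleftrightarrow> (\<forall>F\<in>K. (\<Sum>G\<in>{G \<in> K. F \<subseteq> G}. (- 1) ^ card G) = ((- 1) ^ d :: int))"

lemma finite_complex_link:
  assumes "finite_complex V K" and "F \<in> K"
  shows "finite_complex V (link F K)"
proof -
  interpret finite_complex V K by fact
  show ?thesis
  proof
    have "G \<in> link F K" if "G' \<in> link F K" "G \<subseteq> G'" for G G'
      using that face_subset[of "F \<union> G'" "F \<union> G"] face_subset[of G' G] by (auto simp: link_def)
    moreover have "link F K \<subseteq> K"
      by (auto simp: link_def)
    moreover have "{} \<in> link F K"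
      using assms(2) empty_face by (simp add: link_def)
    ultimately show "simplicial_complex V (link F K)"
      using complex unfolding simplicial_complex_def by blast
  qed
qed

text \<open>The faces containing \<open>F\<close> are the unions of \<open>F\<close> with the faces
  of its link, which shifts the sum by the sign of \<open>card F\<close>. The link has the Euler
  characteristic of a sphere of its own dimension, and purity determines that dimension from
  \<open>card F\<close>.\<close>

lemma eulerian_if_gorenstein_star:
  assumes "simplicial_complex V K" and gor: "gorenstein_star K" and d: "complex_dim K = int d - 1"
  shows "eulerian d K"
  unfolding eulerian_def
proof
  fix F assume F: "F \<in> K"
  interpret K: finite_complex V K
    by unfold_locales fact
  interpret L: finite_complex V "link F K"
    by (rule finite_complex_link[OF K.finite_complex_axioms F])
  have card_le: "card G \<le> d" if "G \<in> K" for G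
    using card_le_complex_dim[OF assms(1) d] that by blast
  have card_Un: "card (F \<union> G) = card F + card G" if "G \<in> link F K" for G
    using that K.finite_face F by (intro card_Un_disjoint) (auto simp: link_def)
  have card_link: "card G \<le> d - card F" if "G \<in> link F K" for G
    using card_Un[OF that] card_le[of "F \<union> G"] that by (auto simp: link_def)
  \<comment> \<open>By purity a maximal face above \<open>F\<close> has \<open>d\<close> elements,
    so removing \<open>F\<close> from it gives a face of the link of largest possible size.\<close>
  obtain M where M: "M \<in> K" "F \<subseteq> M" "\<forall>G\<in>K. M \<subseteq> G \<longrightarrow> G = M"
    using finite_has_maximal2[OF K.finite_K F] by metis
  then have card_M: "card M = d"
    using gor d by (auto simp: gorenstein_star_def pure_complex_def)
  have "M - F \<in> link F K"
    using M K.face_subset[of M "M - F"] by (auto simp: link_def Un_absorb1)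
  moreover have "card (M - F) = d - card F"
    using M card_M K.finite_face F by (simp add: card_Diff_subset)
  ultimately have "Max (card ` link F K) = d - card F"
    using card_link L.finite_K by (intro Max_eqI) (auto intro: rev_image_eqI)
  then have dim: "complex_dim (link F K) = int (d - card F) - 1"
    by (simp add: complex_dim_def)
  have "has_homology_of_sphere (link F K) (complex_dim (link F K))"
    using gor F by (simp add: gorenstein_star_def)
  then have betti: "reduced_betti (link F K) k = (if k = d - card F then 1 else 0)" for k
    by (auto simp: has_homology_of_sphere_def dim)
  have "(\<Sum>G\<in>link F K. (- 1) ^ card G) = (\<Sum>k\<le>d - card F. int (reduced_betti (link F K) k) * (- 1) ^ k)"
    by (rule L.euler_poincare[OF card_link])
  also have "\<dots> = (- 1) ^ (d - card F)"
    by (simp add: betti if_distrib[of int] if_distrib[of "\<lambda>x. x * _"] cong: if_cong)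
  finally have link: "(\<Sum>G\<in>link F K. (- 1) ^ card G) = ((- 1) ^ (d - card F) :: int)" .
  have "(\<Sum>G\<in>{G \<in> K. F \<subseteq> G}. (- 1) ^ card G) = (\<Sum>G\<in>link F K. (- 1) ^ card (F \<union> G) :: int)"
    by (rule sum.reindex_bij_witness[of _ "\<lambda>G. F \<union> G" "\<lambda>G. G - F"])
      (auto simp: link_def Un_absorb1 intro: K.face_subset)
  also have "\<dots> = (\<Sum>G\<in>link F K. (- 1) ^ card F * (- 1) ^ card G)"
    by (intro sum.cong refl) (simp add: card_Un power_add)
  also have "\<dots> = (- 1) ^ card F * (- 1) ^ (d - card F)"
    by (simp add: sum_distrib_left[symmetric] link)
  also have "\<dots> = (- 1) ^ d"
    using card_le[OF F] by (simp add: power_add[symmetric])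
  finally show "(\<Sum>G\<in>{G \<in> K. F \<subseteq> G}. (- 1) ^ card G) = ((- 1) ^ d :: int)" .
qed

text \<open>As the vertex sets are disjoint, a face of the join is a unique pair of faces and its
  cardinality is the sum of theirs, so the sum factors.\<close>

lemma eulerian_join:
  assumes K: "simplicial_complex V K" and L: "simplicial_complex W L" and disj: "V \<inter> W = {}"
    and eul: "eulerian d K" "eulerian e L"
  shows "eulerian (d + e) (complex_join K L)"
  unfolding eulerian_def
proof
  fix F assume "F \<in> complex_join K L"
  then obtain A B where F: "F = A \<union> B" "A \<in> K" "B \<in> L"
    by (auto simp: complex_join_def)
  interpret K: finite_complex V K
    by unfold_locales fact
  interpret L: finite_complex W L
    by unfold_locales fact
  have sub: "X \<subseteq> V" if "X \<in> K" for X
    using K that by (auto simp: simplicial_complex_def)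
  have sub': "X \<subseteq> W" if "X \<in> L" for X
    using L that by (auto simp: simplicial_complex_def)
  let ?P = "{X \<in> K. A \<subseteq> X} \<times> {Y \<in> L. B \<subseteq> Y}"
  have "(\<Sum>G\<in>{G \<in> complex_join K L. F \<subseteq> G}. (- 1) ^ card G) = (\<Sum>(X, Y)\<in>?P. (- 1) ^ card (X \<union> Y) :: int)"
  proof (rule sum.reindex_bij_witness[of _ "\<lambda>(X, Y). X \<union> Y" "\<lambda>G. (G \<inter> V, G \<inter> W)"])
    fix G assume "G \<in> {G \<in> complex_join K L. F \<subseteq> G}"
    then obtain X Y where G: "G = X \<union> Y" "X \<in> K" "Y \<in> L" "F \<subseteq> G"
      by (auto simp: complex_join_def)
    then have GV: "G \<inter> V = X" "G \<inter> W = Y"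
      using sub[OF G(2)] sub'[OF G(3)] disj by auto
    show "(case (G \<inter> V, G \<inter> W) of (X, Y) \<Rightarrow> X \<union> Y) = G"
      using GV G(1) by simp
    have "A \<subseteq> G \<inter> V" "B \<subseteq> G \<inter> W"
      using G(4) F sub[OF F(2)] sub'[OF F(3)] by auto
    then show "(G \<inter> V, G \<inter> W) \<in> ?P"
      unfolding GV using G(2,3) by simp
    show "(case (G \<inter> V, G \<inter> W) of (X, Y) \<Rightarrow> (- 1) ^ card (X \<union> Y)) = ((- 1) ^ card G :: int)"
      using GV G(1) by simp
  next
    fix p assume "p \<in> ?P"
    then obtain X Y where p: "p = (X, Y)" "X \<in> K" "Y \<in> L" "A \<subseteq> X" "B \<subseteq> Y"
      by auto
    then show "(\<lambda>G. (G \<inter> V, G \<inter> W)) (case p of (X, Y) \<Rightarrow> X \<union> Y) = p"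
      using sub[OF p(2)] sub'[OF p(3)] disj by auto
    show "(case p of (X, Y) \<Rightarrow> X \<union> Y) \<in> {G \<in> complex_join K L. F \<subseteq> G}"
      using p F(1) by (auto simp: complex_join_def)
  qed
  also have "\<dots> = (\<Sum>(X, Y)\<in>?P. (- 1) ^ card X * (- 1) ^ card Y)"
  proof (rule sum.cong[OF refl])
    fix p assume "p \<in> ?P"
    then obtain X Y where p: "p = (X, Y)" "X \<in> K" "Y \<in> L"
      by auto
    then have "card (X \<union> Y) = card X + card Y"
      using sub[OF p(2)] sub'[OF p(3)] disj K.finite_face L.finite_face by (intro card_Un_disjoint) auto
    then show "(case p of (X, Y) \<Rightarrow> (- 1) ^ card (X \<union> Y)) = ((case p of (X, Y) \<Rightarrow> (- 1) ^ card X * (- 1) ^ card Y) :: int)"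
      by (simp add: p(1) power_add)
  qed
  also have "\<dots> = (\<Sum>X\<in>{X \<in> K. A \<subseteq> X}. (- 1) ^ card X) * (\<Sum>Y\<in>{Y \<in> L. B \<subseteq> Y}. (- 1) ^ card Y)"
    by (simp add: sum_product sum.cartesian_product)
  also have "\<dots> = (- 1) ^ d * (- 1) ^ e"
    using eul F(2,3) by (simp add: eulerian_def)
  finally show "(\<Sum>G\<in>{G \<in> complex_join K L. F \<subseteq> G}. (- 1) ^ card G) = ((- 1) ^ (d + e) :: int)"
    by (simp add: power_add)
qed

text \<open>\<open>(-1)\<^sup>j h_coeff d j i\<close> is the coefficient of \<open>t\<^sup>j\<close> in \<open>t\<^sup>i (1 - t)\<^bsup>d-i\<^esup>\<close>.\<close>

definition h_coeff :: "nat \<Rightarrow> nat \<Rightarrow> nat \<Rightarrow> int" where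
  "h_coeff d j i = (if i \<le> j then (- 1) ^ i * int ((d - i) choose (j - i)) else 0)"

text \<open>By the binomial theorem, summing t^|F| (1-t)^(d-|F|) over the subsets F of G gives
  (1-t)^(d-|G|) (t + (1-t))^|G| = (1-t)^(d-|G|). The claim compares the coefficients of t^j, up to
  the sign (-1)^j.\<close>

lemma sum_subsets_h_coeff:
  "finite G \<Longrightarrow> card G \<le> d \<Longrightarrow> (\<Sum>F\<in>Pow G. h_coeff d j (card F)) = int ((d - card G) choose j)"
proof (induction G arbitrary: d j rule: finite_induct)
  case (insert x G)
  obtain d' where d: "d = Suc d'" "card G \<le> d'"
    using insert by (cases d) auto
  have fin: "F \<in> Pow G \<Longrightarrow> finite F" "F \<in> Pow G \<Longrightarrow> x \<notin> F" for F
    using insert finite_subset by blast+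
  have inj: "inj_on (insert x) (Pow G)"
    using insert(2) by (intro inj_onI) (metis Pow_iff insert_ident subset_iff)
  have "(\<Sum>F\<in>Pow (insert x G). h_coeff d j (card F)) =
      (\<Sum>F\<in>Pow G. h_coeff d j (card F)) + (\<Sum>F\<in>insert x ` Pow G. h_coeff d j (card F))"
    unfolding Pow_insert using insert by (intro sum.union_disjoint) auto
  also have "(\<Sum>F\<in>insert x ` Pow G. h_coeff d j (card F)) = (\<Sum>F\<in>Pow G. h_coeff d j (Suc (card F)))"
    unfolding sum.reindex[OF inj] using fin by (intro sum.cong) auto
  also have "(\<Sum>F\<in>Pow G. h_coeff d j (card F)) = int ((d - card G) choose j)"
    using insert.IH[of d j] d by simp
  finally have sum: "(\<Sum>F\<in>Pow (insert x G). h_coeff d j (card F)) =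
      int ((d - card G) choose j) + (\<Sum>F\<in>Pow G. h_coeff d j (Suc (card F)))" .
  show ?case
  proof (cases j)
    case 0
    then show ?thesis
      unfolding sum by (simp add: h_coeff_def)
  next
    case (Suc j')
    \<comment> \<open>Adding \<open>x\<close> to a subset multiplies t^i (1-t)^(d'-i) by t. This
      lowers \<open>j\<close> by one, and the sign comes from the factor (-1)^j left out of
      \<open>h_coeff\<close>. Pascal's rule then finishes the step.\<close>
    have "h_coeff d j (Suc i) = - h_coeff d' j' i" for i
      by (simp add: h_coeff_def d Suc)
    then have "(\<Sum>F\<in>Pow G. h_coeff d j (Suc (card F))) = - int ((d' - card G) choose j')"
      using insert.IH[of d' j'] d by (simp add: sum_negf)
    then show ?thesis
      unfolding sum using insert d Suc by (simp add: Suc_diff_le)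
  qed
qed (simp add: h_coeff_def)

text \<open>Let h(t) be the sum of t^|F| (1-t)^(d-|F|) over the faces F. Inserting the Eulerian sum,
  which equals 1, for each F and exchanging the two summations turns h(t) into the sum of
  (t-1)^(d-|G|) over the faces G. That is t^d h(1/t), the polynomial with reversed
  coefficients.\<close>

lemma symmetric_h_vector_if_eulerian:
  assumes cx: "simplicial_complex V K" and d: "complex_dim K = int d - 1" and eul: "eulerian d K"
  shows "symmetric_h_vector K"
proof -
  interpret finite_complex V K
    by unfold_locales fact
  have card_le: "card F \<le> d" if "F \<in> K" for F
    using card_le_complex_dim[OF cx d] that by blast
  have nat_d: "nat (complex_dim K + 1) = d"
    using d by simp
  have h: "h_vector K j = (\<Sum>F\<in>K. (- 1) ^ j * h_coeff d j (card F))" if "j \<le> d" for j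
  proof -
    have "(- 1) ^ (j - i) * int ((d - i) choose (j - i)) = (- 1) ^ j * h_coeff d j i" if "i \<le> j" for i
    proof -
      have "(- 1) ^ j * (- 1) ^ i = ((- 1) ^ (j - i) :: int)"
        using that by (auto simp: minus_one_power_iff)
      then show ?thesis
        using that by (simp add: h_coeff_def mult.assoc[symmetric])
    qed
    then have "h_vector K j = (\<Sum>i\<le>j. int (card {F \<in> K. card F = i}) * ((- 1) ^ j * h_coeff d j i))"
      unfolding h_vector_def nat_d Let_def by (intro sum.cong) (simp_all add: mult.commute)
    also have "\<dots> = (\<Sum>i\<le>d. int (card {F \<in> K. card F = i}) * ((- 1) ^ j * h_coeff d j i))"
      using that by (intro sum.mono_neutral_left) (auto simp: h_coeff_def)
    also have "\<dots> = (\<Sum>F\<in>K. (- 1) ^ j * h_coeff d j (card F))"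
      by (rule sum_faces_by_card[symmetric, OF card_le])
    finally show ?thesis .
  qed
  have "h_vector K j = h_vector K (d - j)" if j: "j \<le> d" for j
  proof -
    have one: "(- 1) ^ d * (\<Sum>G\<in>{G \<in> K. F \<subseteq> G}. (- 1) ^ card G) = (1 :: int)" if "F \<in> K" for F
      using eul that by (simp add: eulerian_def power_add[symmetric])
    have "h_vector K j = (\<Sum>F\<in>K. (- 1) ^ j * h_coeff d j (card F) *
        ((- 1) ^ d * (\<Sum>G\<in>{G \<in> K. F \<subseteq> G}. (- 1) ^ card G)))"
      unfolding h[OF j] by (intro sum.cong refl) (simp add: one)
    also have "\<dots> = (\<Sum>F\<in>K. \<Sum>G\<in>{G \<in> K. F \<subseteq> G}. (- 1) ^ j * (- 1) ^ d * (- 1) ^ card G * h_coeff d j (card F))"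
      by (simp add: sum_distrib_left mult_ac)
    also have "\<dots> = (\<Sum>G\<in>K. \<Sum>F\<in>{F \<in> K. F \<subseteq> G}. (- 1) ^ j * (- 1) ^ d * (- 1) ^ card G * h_coeff d j (card F))"
      by (rule sum.swap_restrict) (use finite_K in auto)
    also have "\<dots> = (\<Sum>G\<in>K. (- 1) ^ (d - j) * h_coeff d (d - j) (card G))"
    proof (rule sum.cong[OF refl])
      fix G assume G: "G \<in> K"
      have "{F \<in> K. F \<subseteq> G} = Pow G"
        using G face_subset by auto
      then have "(\<Sum>F\<in>{F \<in> K. F \<subseteq> G}. (- 1) ^ j * (- 1) ^ d * (- 1) ^ card G * h_coeff d j (card F)) =
          (- 1) ^ j * (- 1) ^ d * (- 1) ^ card G * int ((d - card G) choose j)"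
        using sum_subsets_h_coeff[OF finite_face[OF G] card_le[OF G], of j]
        by (simp add: sum_distrib_left[symmetric])
      moreover have "(- 1) ^ j * (- 1) ^ d = ((- 1) ^ (d - j) :: int)"
        using j by (auto simp: minus_one_power_iff)
      \<comment> \<open>Symmetry of the binomial coefficient; if \<open>card G\<close> exceeds d -
        j, then j exceeds d - \<open>card G\<close> and both sides are 0.\<close>
      moreover have "(- 1) ^ card G * int ((d - card G) choose j) = h_coeff d (d - j) (card G)"
      proof (cases "card G \<le> d - j")
        case True
        then have "(d - card G) choose j = (d - card G) choose (d - j - card G)"
          using j by (subst binomial_symmetric) (auto simp: diff_right_commute)
        then show ?thesis
          using True by (simp add: h_coeff_def)
      next
        case False
        then show ?thesis
          using card_le[OF G] j by (simp add: h_coeff_def binomial_eq_0)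
      qed
      ultimately show "(\<Sum>F\<in>{F \<in> K. F \<subseteq> G}. (- 1) ^ j * (- 1) ^ d * (- 1) ^ card G * h_coeff d j (card F)) =
          (- 1) ^ (d - j) * h_coeff d (d - j) (card G)"
        by (simp add: mult.assoc)
    qed
    also have "\<dots> = h_vector K (d - j)"
      by (rule h[symmetric]) simp
    finally show ?thesis .
  qed
  then show ?thesis
    unfolding symmetric_h_vector_def nat_d Let_def by blast
qed

theorem mainTheorem3:
  fixes V\<^sub>K V\<^sub>L :: "'v set" and K L :: "'v set set" and d\<^sub>K d\<^sub>L :: nat
    and \<Theta>\<^sub>K \<Theta>\<^sub>L :: "'v mpoly list" and \<omega>\<^sub>K \<omega>\<^sub>L :: "'v mpoly"
  assumes "simplicial_complex V\<^sub>K K" and "simplicial_complex V\<^sub>L L"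
    and "V\<^sub>K \<inter> V\<^sub>L = {}"
    and "gorenstein_star K" and "gorenstein_star L"
    and "complex_dim K = int d\<^sub>K - 1" and "complex_dim L = int d\<^sub>L - 1"
    and "is_lsop V\<^sub>K K \<Theta>\<^sub>K" and "is_lsop V\<^sub>L L \<Theta>\<^sub>L"
    and "\<omega>\<^sub>K \<in> homogeneous_polys V\<^sub>K 1"
    and "HL_element V\<^sub>K K \<Theta>\<^sub>K (reduced_class V\<^sub>K K \<Theta>\<^sub>K \<omega>\<^sub>K)"
    and "\<omega>\<^sub>L \<in> homogeneous_polys V\<^sub>L 1"
    and "HL_element V\<^sub>L L \<Theta>\<^sub>L (reduced_class V\<^sub>L L \<Theta>\<^sub>L \<omega>\<^sub>L)"
  shows "(complex_dim (complex_join K L) = int d\<^sub>K + int d\<^sub>L - 1 \<and>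
           symmetric_h_vector (complex_join K L)) \<and>
         is_lsop (V\<^sub>K \<union> V\<^sub>L) (complex_join K L) (\<Theta>\<^sub>K @ \<Theta>\<^sub>L) \<and>
         HL_element (V\<^sub>K \<union> V\<^sub>L) (complex_join K L) (\<Theta>\<^sub>K @ \<Theta>\<^sub>L)
           (reduced_class (V\<^sub>K \<union> V\<^sub>L) (complex_join K L) (\<Theta>\<^sub>K @ \<Theta>\<^sub>L) (\<omega>\<^sub>K + \<omega>\<^sub>L))"
proof (intro conjI)
  have pres: "face_presentation V\<^sub>K K \<Theta>\<^sub>K" "face_presentation V\<^sub>L L \<Theta>\<^sub>L"
    using assms(1,2,8,9)
    by (auto simp: face_presentation_def face_presentation_axioms_def presentation_def
        simplicial_complex_def is_lsop_def)
  show dim: "complex_dim (complex_join K L) = int d\<^sub>K + int d\<^sub>L - 1"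
    using complex_dim_join assms(1-3,6,7) by blast
  have "eulerian (d\<^sub>K + d\<^sub>L) (complex_join K L)"
    using assms(1-7) by (intro eulerian_join eulerian_if_gorenstein_star)
  then show "symmetric_h_vector (complex_join K L)"
    using dim by (intro symmetric_h_vector_if_eulerian[OF simplicial_complex_join[OF assms(1,2)]]) auto
  show "is_lsop (V\<^sub>K \<union> V\<^sub>L) (complex_join K L) (\<Theta>\<^sub>K @ \<Theta>\<^sub>L)"
    by (rule lsop_join[OF pres assms(3,6,7,8,9)])
  show "HL_element (V\<^sub>K \<union> V\<^sub>L) (complex_join K L) (\<Theta>\<^sub>K @ \<Theta>\<^sub>L)
      (reduced_class (V\<^sub>K \<union> V\<^sub>L) (complex_join K L) (\<Theta>\<^sub>K @ \<Theta>\<^sub>L) (\<omega>\<^sub>K + \<omega>\<^sub>L))"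
    by (rule HL_element_join[OF pres assms(3,6,7,8,9,10,12,11,13)])
qed

end
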